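(* Let $\lambda\in\mathbb{R}$, $\delta>0$, $\alpha>|\beta|\geq 0$, and let $W$ be a real-valued random variable. Then $W$ follows the $GH(\lambda,\alpha,\beta,\delta,0)$ distribution if and only if $$\mathbb{E}[\mathcal{A}_{\lambda,\alpha,\beta,\delta}f(W)]=0$$ for all piecewise twice continuously differentiable functions $f:\mathbb{R}\rightarrow\mathbb{R}$ for which $\mathbb{E}|\mathcal{A}_{\lambda,\alpha,\beta,\delta}f(Z)|<\infty$ for $Z\sim GH(\lambda,\alpha,\beta,\delta,0)$, and $$\lim_{|x|\rightarrow\infty}|x|^\lambda \mathrm{e}^{-\alpha|x|+\beta x}f^{(k)}(x)=0$$ for $k=0,1,2$, where $f^{(0)}\equiv f$.
   Context: The modified Bessel function of the second kind of order $\nu\in\mathbb{R}$ is $K_\nu(x)=\int_0^\infty \mathrm{e}^{-x\cosh(t)}\cosh(\nu t)\,\mathrm{d}t$ for $x>0$. For $\lambda\in\mathbb{R}$, $\delta>0$, $\alpha>|\beta|\geq0$, the generalized hyperbolic distribution $GH(\lambda,\alpha,\beta,\delta,0)$ (with location parameter $\mu=0$) is the probability distribution on $\mathbb{R}$ with density $$p(x)=\frac{(\alpha^2 - \beta^2)^{\lambda/2}}{\sqrt{2\pi}\, \alpha^{\lambda -\frac{1}{2}}\delta^{\lambda}K_{\lambda}(\delta\sqrt{\alpha^2-\beta^2})}\,\mathrm{e}^{\beta x}(\delta^2+x^2)^{(\lambda-\frac{1}{2})/2}K_{\lambda-\frac{1}{2}}(\alpha\sqrt{\delta^2+x^2}),\quad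 x\in\mathbb{R}.$$ The $GH(\lambda,\alpha,\beta,\delta,0)$ Stein operator is $$\mathcal{A}_{\lambda,\alpha,\beta,\delta}f(x)=\frac{x^2+\delta^2}{x}f''(x)+\bigg[2\lambda+2\beta x+\frac{2\beta\delta^2}{x}-\frac{\delta^2}{x^2}\bigg]f'(x)+\bigg[2\lambda\beta-(\alpha^2-\beta^2)x+\frac{\beta^2\delta^2}{x}-\frac{\beta\delta^2}{x^2}\bigg]f(x).$$
   Formalization: Test functions f are required to be continuously differentiable with f' piecewise C^1 and f''(0) existing (else f=x|x| cut off, with beta=0, violates the identity); E[Af(W)]=0 is read as: W is nonzero a.s., Af(W) is integrable and has mean 0. *)

theory Defs
  imports "HOL-Probability.Probability"
begin

definition bessel_K :: "real \<Rightarrow> real \<Rightarrow> real" where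
  "bessel_K \<nu> x = (LINT t:{0..}|lborel. exp (- x * cosh t) * cosh (\<nu> * t))"

definition gh_density :: "real \<Rightarrow> real \<Rightarrow> real \<Rightarrow> real \<Rightarrow> real \<Rightarrow> real" where
  "gh_density lam \<alpha> \<beta> \<delta> x =
     (\<alpha>\<^sup>2 - \<beta>\<^sup>2) powr (lam / 2)
       / (sqrt (2 * pi) * \<alpha> powr (lam - 1/2) * \<delta> powr lam
            * bessel_K lam (\<delta> * sqrt (\<alpha>\<^sup>2 - \<beta>\<^sup>2)))
     * exp (\<beta> * x) * (\<delta>\<^sup>2 + x\<^sup>2) powr ((lam - 1/2) / 2)
     * bessel_K (lam - 1/2) (\<alpha> * sqrt (\<delta>\<^sup>2 + x\<^sup>2))"

definition gh_measure :: "real \<Rightarrow> real \<Rightarrow> real \<Rightarrow> real \<Rightarrow> real measure" where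
  "gh_measure lam \<alpha> \<beta> \<delta> = density lborel (\<lambda>x. ennreal (gh_density lam \<alpha> \<beta> \<delta> x))"

(* The operator has poles at x = 0; the value that division by zero gives there is
   meaningless, so taking an expectation of it presupposes that 0 has probability 0. *)
definition gh_stein_op ::
    "real \<Rightarrow> real \<Rightarrow> real \<Rightarrow> real \<Rightarrow> (real \<Rightarrow> real) \<Rightarrow> real \<Rightarrow> real" where
  "gh_stein_op lam \<alpha> \<beta> \<delta> f x =
     (x\<^sup>2 + \<delta>\<^sup>2) / x * deriv (deriv f) x
     + (2 * lam + 2 * \<beta> * x + 2 * \<beta> * \<delta>\<^sup>2 / x - \<delta>\<^sup>2 / x\<^sup>2) * deriv f x
     + (2 * lam * \<beta> - (\<alpha>\<^sup>2 - \<beta>\<^sup>2) * x + \<beta>\<^sup>2 * \<delta>\<^sup>2 / x - \<beta> * \<delta>\<^sup>2 / x\<^sup>2) * f x"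

(* f is continuously differentiable, and f'' exists and is continuous off a finite set.
   Jumps of f' are excluded: integrating a second-order operator by parts across one
   leaves a boundary term. *)
definition piecewise_C2 :: "(real \<Rightarrow> real) \<Rightarrow> bool" where
  "piecewise_C2 f \<longleftrightarrow>
     (\<forall>x. f differentiable (at x)) \<and> deriv f piecewise_C1_differentiable_on UNIV"

(* f'' must also exist at the pole 0 of the operator. With \<beta> = 0, a cut-off of x * \<bar>x\<bar>
   is piecewise_C2 and its image under gh_stein_op is bounded, but the mean of that image
   is not 0: f'(x) / x has different one-sided limits at 0. *)
definition gh_test_function ::
    "real \<Rightarrow> real \<Rightarrow> real \<Rightarrow> real \<Rightarrow> (real \<Rightarrow> real) \<Rightarrow> bool" where
  "gh_test_function lam \<alpha> \<beta> \<delta> f \<longleftrightarrow>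
     piecewise_C2 f \<and> deriv f differentiable (at 0) \<and>
     integrable (gh_measure lam \<alpha> \<beta> \<delta>) (gh_stein_op lam \<alpha> \<beta> \<delta> f) \<and>
     (\<forall>k\<in>{0, 1, 2}.
        ((\<lambda>x. \<bar>x\<bar> powr lam * exp (- \<alpha> * \<bar>x\<bar> + \<beta> * x) * (deriv ^^ k) f x) \<longlongrightarrow> 0) at_infinity)"

end

theory Submission
  imports Defs "HOL-Real_Asymp.Real_Asymp"
begin

text \<open>
  Write \<open>y = x\<^sup>2 + \<delta>\<^sup>2\<close>, \<open>s = sqrt y\<close>, \<open>\<nu> = lam - 1/2\<close> and \<open>H \<nu> y = 2 s\<^sup>\<nu> K \<nu> (\<alpha> s)\<close>.
  Up to a constant the density is \<open>exp (\<beta> x) H \<nu> y\<close>.  The substitution \<open>g = exp (\<beta> x) f\<close> removes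
  \<open>\<beta>\<close> from the operator: \<open>exp (\<beta> x)\<close> times \<open>gh_stein_op\<close> applied to \<open>f\<close> equals
  \<open>L g = (y / x) g'' + (2 lam - \<delta>\<^sup>2 / x\<^sup>2) g' - \<alpha>\<^sup>2 x g\<close>.  The derivative formula
  \<open>d/dy H \<nu> = - (\<alpha> / 2) H (\<nu> - 1)\<close> and the recurrence
  \<open>2 \<nu> H \<nu> + \<alpha> y H (\<nu> - 1) = \<alpha> H (\<nu> + 1)\<close> of the Bessel functions then turn \<open>H \<nu> (L g)\<close> into an
  exact derivative \<open>F'\<close>, where \<open>F = H \<nu> (y / x) g' + \<alpha> H (\<nu> + 1) g\<close> is the flux
  (lemma \<open>has_derivative_stein_flux\<close>).  Everything is read off from this identity.

  If W has the density, the expectation of the operator is the total increment of the flux over the two half lines.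
  Since \<open>H \<nu> y\<close> has the exact order \<open>s powr (\<nu> - 1/2) * exp (- \<alpha> s)\<close>, the growth conditions make the
  flux vanish at both infinities.  At the pole 0, integrability gives the flux finite one-sided
  limits; hence \<open>g' / x\<close> has one-sided limits there, which forces \<open>g' 0 = 0\<close>, and as \<open>g''\<close> exists at 0
  both limits of \<open>g' / x\<close> equal \<open>g'' 0\<close>.  The two limits of the flux agree, and the contributions of the
  half lines cancel (lemma \<open>stein_identity_gh\<close>).

  Conversely, for every bounded continuous \<open>h\<close> of mean zero under the GH law the Stein equation has a
  solution \<open>f\<close> among the test functions (lemma \<open>stein_equation_solvable\<close>).  Prescribing the flux to be
  the primitive \<open>F\<close> of \<open>exp (\<beta> x) H \<nu> h\<close> that vanishes at both infinities leaves a first-order linear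
  equation for \<open>g\<close>.  Its homogeneous solution is \<open>y powr - \<nu> * H \<nu> y\<close>, and variation of constants gives
  \<open>g' = x G\<close> with \<open>G\<close> continuously differentiable: the pole at 0 disappears.  L'Hopital's rule together with
  the two-sided bounds on \<open>H\<close> gives the growth conditions.  Taking for \<open>h\<close> the centred functions
  \<open>cos (t x)\<close> and \<open>sin (t x)\<close> shows that W has the GH characteristic function, and Levy's uniqueness
  theorem applies.  Centring needs the GH density to have total mass one, which Fubini's theorem reduces to
  a Gaussian integral (lemma \<open>gh_normalisation\<close>).
\<close>

section \<open>Increments of functions with integrable derivative\<close>

lemma set_integral_eq_increment:
  fixes F \<phi> :: "real \<Rightarrow> real"
  assumes "finite S" "a \<le> b" and cont: "continuous_on {a..b} F"
    and deriv: "\<And>x. x \<in> {a<..<b} - S \<Longrightarrow> (F has_real_derivative \<phi> x) (at x)"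
    and int: "set_integrable lborel {a..b} \<phi>"
  shows "(LINT x:{a..b}|lborel. \<phi> x) = F b - F a"
proof -
  have "(\<phi> has_integral (F b - F a)) {a..b}"
    using fundamental_theorem_of_calculus_interior_strong[OF assms(1,2) _ cont, of \<phi>] deriv
    by (auto simp: has_real_derivative_iff_has_vector_derivative)
  then show ?thesis
    using set_borel_integral_eq_integral(2)[OF int] by (simp add: integral_unique)
qed

text \<open>
  The fundamental theorem of calculus on a half line whose finite endpoint may be a singularity of
  the derivative: the integrability of \<open>\<phi>\<close> up to 0 makes the tails \<open>L - F x\<close> converge as x decreases to 0.
  The set S absorbs the points where a piecewise smooth function has no derivative.
\<close>

lemma improper_increment_right:
  fixes F \<phi> :: "real \<Rightarrow> real"
  assumes S: "finite S" and cont: "continuous_on {0<..} F"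
    and deriv: "\<And>x. 0 < x \<Longrightarrow> x \<notin> S \<Longrightarrow> (F has_real_derivative \<phi> x) (at x)"
    and int: "set_integrable lborel {0<..} \<phi>"
    and L: "(F \<longlongrightarrow> L) at_top"
  shows "(F \<longlongrightarrow> L - (LINT x:{0<..}|lborel. \<phi> x)) (at_right 0)"
proof -
  have tail: "(LINT t:{x..}|lborel. \<phi> t) = L - F x" if x: "0 < x" for x
  proof -
    have intx: "set_integrable lborel {x..} \<phi>"
      by (rule set_integrable_subset[OF int]) (use x in auto)
    have "((\<lambda>b. LINT t:{x..b}|lborel. \<phi> t) \<longlongrightarrow> (LINT t:{x..}|lborel. \<phi> t)) at_top"
      by (rule tendsto_set_lebesgue_integral_at_top[OF _ intx]) auto
    moreover have "((\<lambda>b. LINT t:{x..b}|lborel. \<phi> t) \<longlongrightarrow> L - F x) at_top"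
    proof (rule Lim_transform_eventually)
      show "((\<lambda>b. F b - F x) \<longlongrightarrow> L - F x) at_top" by (intro tendsto_intros L)
      show "\<forall>\<^sub>F b in at_top. F b - F x = (LINT t:{x..b}|lborel. \<phi> t)"
        using eventually_ge_at_top[of x]
      proof eventually_elim
        case (elim b)
        have "continuous_on {x..b} F" by (rule continuous_on_subset[OF cont]) (use x in auto)
        moreover have "set_integrable lborel {x..b} \<phi>"
          by (rule set_integrable_subset[OF intx]) auto
        ultimately show ?case
          using set_integral_eq_increment[OF S elim, of F \<phi>] deriv x by auto
      qed
    qed
    ultimately show ?thesis using tendsto_unique trivial_limit_at_top_linorder by blast
  qed
  have m: "(\<lambda>x. indicator {0<..} x *\<^sub>R \<phi> x) \<in> borel_measurable lborel"
    using int by (auto simp: set_integrable_def)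
  have "((\<lambda>t. LINT x|lborel. indicator {inverse t..} x *\<^sub>R (indicator {0<..} x *\<^sub>R \<phi> x))
          \<longlongrightarrow> (LINT x|lborel. indicator {0<..} x *\<^sub>R \<phi> x)) at_top"
  proof (rule integral_dominated_convergence_at_top[where w="\<lambda>x. norm (indicator {0<..} x *\<^sub>R \<phi> x)"])
    show "integrable lborel (\<lambda>x. norm (indicator {0<..} x *\<^sub>R \<phi> x))"
      using int unfolding set_integrable_def by (rule integrable_norm)
    show "AE x in lborel. ((\<lambda>t. indicator {inverse t..} x *\<^sub>R indicator {0<..} x *\<^sub>R \<phi> x) \<longlongrightarrow>
                indicator {0<..} x *\<^sub>R \<phi> x) at_top"
    proof (rule AE_I2, rule tendsto_eventually)
      fix x :: real
      show "\<forall>\<^sub>F t in at_top. indicator {inverse t..} x *\<^sub>R indicator {0<..} x *\<^sub>R \<phi> x = indicator {0<..} x *\<^sub>R \<phi> x"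
      proof (cases "0 < x")
        case True
        show ?thesis using eventually_ge_at_top[of "inverse x"] eventually_gt_at_top[of 0]
          by eventually_elim (use True in \<open>auto simp: indicator_def field_simps\<close>)
      qed auto
    qed
    show "\<forall>\<^sub>F t in at_top. AE x in lborel. norm (indicator {inverse t..} x *\<^sub>R indicator {0<..} x *\<^sub>R \<phi> x)
       \<le> norm (indicator {0<..} x *\<^sub>R \<phi> x)"
      by (intro always_eventually allI AE_I2) (auto simp: indicator_def)
  qed (use m in measurable)
  moreover have "\<forall>\<^sub>F t in at_top. L - (LINT x|lborel. indicator {inverse t..} x *\<^sub>R (indicator {0<..} x *\<^sub>R \<phi> x)) = F (inverse t)"
    using eventually_gt_at_top[of 0]
  proof eventually_elim
    case (elim t)
    then have "(\<lambda>x. indicator {inverse t..} x *\<^sub>R (indicator {0<..} x *\<^sub>R \<phi> x)) = (\<lambda>x. indicator {inverse t..} x *\<^sub>R \<phi> x)"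
      using less_le_trans[of 0 "inverse t"] by (auto simp: indicator_def fun_eq_iff)
    then show ?case using tail[of "inverse t"] elim
      by (simp add: set_lebesgue_integral_def)
  qed
  ultimately have "((\<lambda>t. F (inverse t)) \<longlongrightarrow> L - (LINT x:{0<..}|lborel. \<phi> x)) at_top"
    unfolding set_lebesgue_integral_def
    by (intro Lim_transform_eventually[OF tendsto_diff[OF tendsto_const]]) auto
  then show ?thesis by (simp add: filterlim_at_right_to_top)
qed

text \<open>
  The reflection \<open>x \<mapsto> - x\<close> of \<open>improper_increment_right\<close>.
\<close>

lemma improper_increment_left:
  fixes F \<phi> :: "real \<Rightarrow> real"
  assumes S: "finite S" and cont: "continuous_on {..<0} F"
    and deriv: "\<And>x. x < 0 \<Longrightarrow> x \<notin> S \<Longrightarrow> (F has_real_derivative \<phi> x) (at x)"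
    and int: "set_integrable lborel {..<0} \<phi>"
    and L: "(F \<longlongrightarrow> L) at_bot"
  shows "(F \<longlongrightarrow> L + (LINT x:{..<0}|lborel. \<phi> x)) (at_left 0)"
proof -
  define G where "G x = F (- x)" for x
  define \<psi> where "\<psi> x = - \<phi> (- x)" for x
  have ind: "indicator {..<0} (- x) = (indicator {0<..} x :: real)" for x :: real
    by (auto simp: indicator_def)
  have "integrable lborel (\<lambda>x. indicator {..<0} (0 + (-1) * x) *\<^sub>R \<phi> (0 + (-1) * x))"
    using int unfolding set_integrable_def by (rule lborel_integrable_real_affine) simp
  then have i: "set_integrable lborel {0<..} \<psi>"
    unfolding set_integrable_def \<psi>_def by (simp add: ind)
  have e: "(LINT x:{..<0}|lborel. \<phi> x) = - (LINT x:{0<..}|lborel. \<psi> x)"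
    unfolding set_lebesgue_integral_def \<psi>_def
    by (subst lborel_integral_real_affine[where c="-1" and t=0]) (auto simp: ind)
  have "(G \<longlongrightarrow> L - (LINT x:{0<..}|lborel. \<psi> x)) (at_right 0)"
  proof (rule improper_increment_right)
    show "finite (uminus ` S)" using S by simp
    show "continuous_on {0<..} G" unfolding G_def
      by (rule continuous_on_compose2[OF cont]) (auto intro: continuous_intros)
    show "(G \<longlongrightarrow> L) at_top"
      using L unfolding G_def filterlim_at_bot_mirror .
    show "(G has_real_derivative \<psi> x) (at x)" if "0 < x" "x \<notin> uminus ` S" for x
    proof -
      have "- x < 0" "- x \<notin> S" using that by (auto intro: image_eqI[where x="-x"])
      have "(uminus has_real_derivative - 1) (at x)" by (auto intro!: derivative_eq_intros)
      from DERIV_chain2[where g=uminus, OF deriv[OF \<open>- x < 0\<close> \<open>- x \<notin> S\<close>] this]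
      show ?thesis unfolding G_def \<psi>_def by simp
    qed
  qed (rule i)
  then show ?thesis
    unfolding e by (simp add: G_def[abs_def] filterlim_at_left_to_right[of _ _ "0::real"])
qed

text \<open>
  The primitive is the integral over \<open>{..x}\<close>; that it also vanishes at plus infinity is
  the condition of mean zero.
\<close>

lemma primitive_vanishing_at_infinity:
  fixes \<phi> :: "real \<Rightarrow> real"
  assumes cont: "continuous_on UNIV \<phi>" and int: "integrable lborel \<phi>" and zero: "(LINT x|lborel. \<phi> x) = 0"
  shows "\<exists>F. (\<forall>x. (F has_real_derivative \<phi> x) (at x)) \<and> (F \<longlongrightarrow> 0) at_top \<and> (F \<longlongrightarrow> 0) at_bot"
proof -
  have si: "set_integrable lborel A \<phi>" if "A \<in> sets borel" for A
    using integrable_mult_indicator[OF _ int, of A] that by (simp add: set_integrable_def)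
  have m [measurable]: "\<phi> \<in> borel_measurable borel"
    using borel_measurable_continuous_onI[OF cont] .
  define F where "F x = (LINT t:{..x}|lborel. \<phi> t)" for x
  have split: "F b = F a + (LINT t:{a..b}|lborel. \<phi> t)" if "a \<le> b" for a b
  proof -
    have "F b = (LINT t:{..a} \<union> {a<..b}|lborel. \<phi> t)"
      unfolding F_def using that by (intro arg_cong[where f="\<lambda>A. set_lebesgue_integral lborel A \<phi>"]) auto
    also have "\<dots> = F a + (LINT t:{a<..b}|lborel. \<phi> t)"
      unfolding F_def by (rule set_integral_Un) (auto intro: si)
    also have "(LINT t:{a<..b}|lborel. \<phi> t) = (LINT t:{a..b}|lborel. \<phi> t)"
      by (rule set_integral_cong_set)
        (use m in \<open>auto intro!: AE_I[where N="{a}"] simp: set_borel_measurable_def\<close>)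
    finally show ?thesis .
  qed
  have D: "(F has_real_derivative \<phi> x) (at x)" for x
  proof -
    define a b where "a = x - 1" and "b = x + 1"
    have "((\<lambda>u. LBINT t=a..u. \<phi> t) has_vector_derivative \<phi> x) (at x within {a..b})"
      by (rule interval_integral_FTC2) (auto simp: a_def b_def intro: continuous_on_subset[OF cont])
    then have "((\<lambda>u. LBINT t=a..u. \<phi> t) has_real_derivative \<phi> x) (at x)"
      by (simp add: has_real_derivative_iff_has_vector_derivative at_within_Icc_at a_def b_def)
    then have "((\<lambda>u. F a + (LBINT t=a..u. \<phi> t)) has_real_derivative \<phi> x) (at x)"
      by (auto intro!: derivative_eq_intros)
    then show ?thesis
    proof (rule has_field_derivative_transform_within_open[where S="{a<..<b}"])
      show "F a + (LBINT t=a..u. \<phi> t) = F u" if "u \<in> {a<..<b}" for u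
        using that split[of a u] by (simp add: interval_integral_Icc)
    qed (auto simp: a_def b_def)
  qed
  have top: "(F \<longlongrightarrow> 0) at_top"
    using tendsto_integral_at_top[OF _ int] zero by (simp add: F_def[abs_def] set_lebesgue_integral_def)
  have "((\<lambda>a. LINT t:{a..0}|lborel. \<phi> t) \<longlongrightarrow> F 0) at_bot"
    unfolding F_def by (rule tendsto_set_lebesgue_integral_at_bot) (auto intro: si)
  then have "((\<lambda>a. F 0 - (LINT t:{a..0}|lborel. \<phi> t)) \<longlongrightarrow> F 0 - F 0) at_bot"
    by (intro tendsto_intros)
  moreover have "\<forall>\<^sub>F a in at_bot. F 0 - (LINT t:{a..0}|lborel. \<phi> t) = F a"
    using eventually_le_at_bot[of 0] by eventually_elim (use split in simp)
  ultimately have bot: "(F \<longlongrightarrow> 0) at_bot"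
    using Lim_transform_eventually by fastforce
  show ?thesis using D top bot by blast
qed

section \<open>Integrals of Gaussian and double exponential type\<close>

text \<open>
  Completing the square exhibits the integrand as a multiple of a normal density.
\<close>

lemma gaussian_integral_real:
  fixes b m :: real
  assumes m: "0 < m"
  shows "has_bochner_integral lborel (\<lambda>x. exp (b * x - m * x\<^sup>2)) (sqrt (pi / m) * exp (b\<^sup>2 / (4 * m)))"
proof -
  define \<sigma> where "\<sigma> = sqrt (1 / (2 * m))"
  have s2: "\<sigma>\<^sup>2 = 1 / (2 * m)" and s0: "0 < \<sigma>" using m by (auto simp: \<sigma>_def)
  have "has_bochner_integral lborel (normal_density (b / (2*m)) \<sigma>) 1"
    using has_bochner_integral_integrable[OF integrable_normal_density[OF s0]] s0 by simp
  from has_bochner_integral_mult_right[OF this, of "sqrt (pi / m) * exp (b\<^sup>2 / (4 * m))"]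
  have "has_bochner_integral lborel (\<lambda>x. sqrt (pi / m) * exp (b\<^sup>2 / (4 * m)) * normal_density (b / (2*m)) \<sigma> x)
     (sqrt (pi / m) * exp (b\<^sup>2 / (4 * m)))" by simp
  moreover have "sqrt (pi / m) * exp (b\<^sup>2 / (4 * m)) * normal_density (b / (2*m)) \<sigma> x = exp (b * x - m * x\<^sup>2)" for x
  proof -
    have "b\<^sup>2 / (4 * m) + - (x - b / (2*m))\<^sup>2 / (2 * \<sigma>\<^sup>2) = b * x - m * x\<^sup>2"
      unfolding s2 using m by (simp add: field_simps power2_eq_square)
    moreover have "sqrt (2 * pi * \<sigma>\<^sup>2) = sqrt (pi / m)" unfolding s2 by simp
    moreover have "sqrt (pi / m) > 0" using m by simp
    ultimately show ?thesis
      using m unfolding normal_density_def by (simp add: exp_add[symmetric])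
  qed
  ultimately show ?thesis by simp
qed

text \<open>
  The sharp constant is 1/2; the factor 1/4 follows from the elementary bounds on the exponential
  alone and still gives Gaussian decay of \<open>exp (- z * cosh t)\<close>.
\<close>

lemma cosh_ge_quadratic: "1 + t\<^sup>2 / 4 \<le> cosh (t :: real)"
proof -
  have *: "1 + s\<^sup>2 / 4 \<le> cosh s" if "0 \<le> s" for s :: real
    using exp_lower_Taylor_quadratic[OF that] exp_ge_add_one_self[of "- s"]
    by (simp add: cosh_field_def field_simps)
  show ?thesis using *[of "\<bar>t\<bar>"] by simp
qed

lemma cosh_le_quadratic:
  fixes t :: real
  assumes "0 \<le> t" "t \<le> 1"
  shows "cosh t \<le> 1 + t\<^sup>2"
proof -
  have "1 \<le> 1 + t\<^sup>2 / 2 + t ^ 3 / 2 + t ^ 4 / 2" using assms by simp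
  also have "\<dots> = (1 - t + t\<^sup>2) * (1 + t + t\<^sup>2 / 2)"
    by (simp add: field_simps power2_eq_square power3_eq_cube power4_eq_xxxx)
  also have "\<dots> \<le> (1 - t + t\<^sup>2) * exp t"
    using assms by (intro mult_left_mono exp_lower_Taylor_quadratic) auto
  finally have "exp (- t) \<le> 1 - t + t\<^sup>2" by (simp add: exp_minus field_simps)
  then show ?thesis using exp_bound[OF assms] by (simp add: cosh_field_def)
qed

text \<open>
  Since \<open>exp u + exp (- u)\<close> grows at least quadratically, the integrand lies below a Gaussian.
\<close>

lemma integrable_exp_double_exponential:
  fixes \<nu> p c :: real
  assumes "0 < p" "0 < c"
  shows "integrable lborel (\<lambda>u. exp (\<nu> * u - p * exp u - c * exp (- u)))"
proof (rule Bochner_Integration.integrable_bound)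
  \<comment> \<open>Replacing both coefficients by their minimum makes the two exponentials symmetric.\<close>
  define m where "m = min p c"
  have m: "0 < m" "m \<le> p" "m \<le> c" using assms by (auto simp: m_def)
  show "integrable lborel (\<lambda>u. exp (\<nu> * u - m / 2 * u\<^sup>2))"
    using gaussian_integral_real[of "m / 2" \<nu>] m by (auto simp: has_bochner_integral_iff)
  have *: "u\<^sup>2 / 2 \<le> exp u + exp (- u)" for u :: real
    using cosh_ge_quadratic[of u] by (simp add: cosh_field_def)
  show "AE u in lborel. norm (exp (\<nu> * u - p * exp u - c * exp (- u))) \<le> norm (exp (\<nu> * u - m / 2 * u\<^sup>2))"
  proof (rule AE_I2)
    fix u
    have "m * (u\<^sup>2 / 2) \<le> m * (exp u + exp (- u))" using * m by (intro mult_left_mono) auto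
    also have "\<dots> \<le> p * exp u + c * exp (- u)"
      using m by (simp add: distrib_left add_mono mult_right_mono)
    finally show "norm (exp (\<nu> * u - p * exp u - c * exp (- u))) \<le> norm (exp (\<nu> * u - m / 2 * u\<^sup>2))" by (simp add: algebra_simps)
  qed
qed measurable


section \<open>The rescaled Bessel function: integral representation and size\<close>

text \<open>
  With \<open>y = s\<^sup>2\<close> this is \<open>2 s\<^sup>\<nu> K \<nu> (\<alpha> s)\<close> (lemma \<open>scaled_bessel_K_eq_bessel_K\<close>), written
  as an integral in which y enters only through one exponential.  In this form differentiation in y lowers the
  order by one, the recurrence is an integration by parts, and the density becomes a mixture of
  Gaussians in x.
\<close>

definition scaled_bessel_K :: "real \<Rightarrow> real \<Rightarrow> real \<Rightarrow> real" where
  "scaled_bessel_K \<alpha> \<nu> y = (LINT u|lborel. exp (\<nu> * u - \<alpha> / 2 * exp u - \<alpha> / 2 * y * exp (- u)))"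

lemma integrable_scaled_bessel_K:
  fixes \<alpha> y \<nu> :: real
  assumes "0 < \<alpha>" "0 < y"
  shows "integrable lborel (\<lambda>u. exp (\<nu> * u - \<alpha> / 2 * exp u - \<alpha> / 2 * y * exp (- u)))"
  using integrable_exp_double_exponential[of "\<alpha> / 2" "\<alpha> / 2 * y" \<nu>] assms by simp

lemma scaled_bessel_K_pos:
  assumes "0 < \<alpha>" "0 < y"
  shows "0 < scaled_bessel_K \<alpha> \<nu> y"
proof -
  have "scaled_bessel_K \<alpha> \<nu> y \<noteq> 0"
    unfolding scaled_bessel_K_def using integrable_scaled_bessel_K[OF assms, of \<nu>]
    by (subst integral_nonneg_eq_0_iff_AE) (auto simp: trivial_limit_def[symmetric] ae_filter_eq_bot_iff)
  moreover have "0 \<le> scaled_bessel_K \<alpha> \<nu> y" unfolding scaled_bessel_K_def by simp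
  ultimately show ?thesis by simp
qed

lemma exp_cosh_eq: "exp (\<nu> * t - z * cosh t) = exp (\<nu> * t - z / 2 * exp t - z / 2 * exp (- t))" for \<nu> t z :: real
  by (simp add: cosh_field_def field_simps)

lemma integrable_exp_cosh:
  fixes z :: real
  assumes "0 < z"
  shows "integrable lborel (\<lambda>t. exp (\<nu> * t - z * cosh t))"
  using integrable_exp_double_exponential[of "z / 2" "z / 2" \<nu>] assms by (simp add: exp_cosh_eq)

text \<open>
  Expanding \<open>cosh (\<nu> t)\<close> splits the integrand into two pieces that are mirror images of each other.
\<close>

lemma bessel_K_eq_full_line:
  assumes z: "0 < z"
  shows "bessel_K \<nu> z = (LINT t|lborel. exp (\<nu> * t - z * cosh t)) / 2"
proof -
  define k where "k t = exp (\<nu> * t - z * cosh t)" for t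
  have k: "integrable lborel k" using integrable_exp_cosh[OF z] by (simp add: k_def[abs_def])
  have k': "integrable lborel (\<lambda>t. k (- t))"
    using lborel_integrable_real_affine[OF k, of "-1" 0] by simp
  have i1: "integrable lborel (\<lambda>t. indicator {0..} t * k t)"
    using integrable_mult_indicator[OF _ k, of "{0..}"] by simp
  have i2: "integrable lborel (\<lambda>t. indicator {0..} t * k (- t))"
    using integrable_mult_indicator[OF _ k', of "{0..}"] by simp
  have i3: "integrable lborel (\<lambda>t. indicator {0..} (- t) * k t)"
    using lborel_integrable_real_affine[OF i2, of "-1" 0] by simp
  have r: "(LINT t|lborel. indicator {0..} t * k (- t)) = (LINT t|lborel. indicator {0..} (- t) * k t)"
    by (subst lborel_integral_real_affine[where c="-1" and t=0]) auto
  have "bessel_K \<nu> z = (LINT t|lborel. (indicator {0..} t * k t + indicator {0..} t * k (- t)) / 2)"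
    unfolding bessel_K_def set_lebesgue_integral_def k_def cosh_field_def[of "\<nu> * _"]
    by (intro Bochner_Integration.integral_cong) (auto simp: exp_diff exp_minus field_simps)
  also have "\<dots> = ((LINT t|lborel. indicator {0..} t * k t) + (LINT t|lborel. indicator {0..} (- t) * k t)) / 2"
    using i1 i2 by (simp add: r[symmetric])
  also have "\<dots> = (LINT t|lborel. indicator {0..} t * k t + indicator {0..} (- t) * k t) / 2"
    using i1 i3 by simp
  also have "(LINT t|lborel. indicator {0..} t * k t + indicator {0..} (- t) * k t) = (LINT t|lborel. k t)"
  proof (rule integral_cong_AE)
    show "AE t in lborel. indicator {0..} t * k t + indicator {0..} (- t) * k t = k t"
      by (rule AE_I[where N="{0}"]) (auto simp: indicator_def)
  qed (use i1 i3 k in \<open>auto intro: borel_measurable_integrable\<close>)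
  finally show ?thesis by (simp add: k_def)
qed

text \<open>
  The translation \<open>u = ln s + t\<close> symmetrises the two exponentials into \<open>cosh\<close>.
\<close>

lemma scaled_bessel_K_eq_exp_cosh:
  assumes s: "0 < s"
  shows "scaled_bessel_K \<alpha> \<nu> (s\<^sup>2) = s powr \<nu> * (LINT t|lborel. exp (\<nu> * t - \<alpha> * s * cosh t))"
proof -
  have "scaled_bessel_K \<alpha> \<nu> (s\<^sup>2) =
      (LINT t|lborel. exp (\<nu> * (ln s + t) - \<alpha> / 2 * exp (ln s + t) - \<alpha> / 2 * s\<^sup>2 * exp (- (ln s + t))))"
    unfolding scaled_bessel_K_def by (subst lborel_integral_real_affine[where c=1 and t="ln s"]) auto
  also have "\<dots> = (LINT t|lborel. s powr \<nu> * exp (\<nu> * t - \<alpha> * s * cosh t))"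
  proof (intro Bochner_Integration.integral_cong refl)
    fix t
    have "exp (ln s + t) = s * exp t" "s\<^sup>2 * exp (- (ln s + t)) = s * exp (- t)"
      using s by (auto simp: exp_add exp_diff exp_minus power2_eq_square field_simps)
    then show "exp (\<nu> * (ln s + t) - \<alpha> / 2 * exp (ln s + t) - \<alpha> / 2 * s\<^sup>2 * exp (- (ln s + t)))
        = s powr \<nu> * exp (\<nu> * t - \<alpha> * s * cosh t)"
      using s by (simp add: powr_def exp_add[symmetric] cosh_field_def mult.assoc) (simp add: field_simps)
  qed
  finally show ?thesis by simp
qed

lemma scaled_bessel_K_eq_bessel_K:
  assumes "0 < \<alpha>" "0 < s"
  shows "scaled_bessel_K \<alpha> \<nu> (s\<^sup>2) = 2 * s powr \<nu> * bessel_K \<nu> (\<alpha> * s)"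
  using assms by (simp add: scaled_bessel_K_eq_exp_cosh bessel_K_eq_full_line)

text \<open>
  The bound \<open>cosh t \<ge> 1 + t\<^sup>2 / 4\<close> leaves a Gaussian integral of variance proportional to
  \<open>1 / (\<alpha> s)\<close>, which supplies the factor \<open>s powr - 1/2\<close>.
\<close>

lemma scaled_bessel_K_upper:
  assumes a: "0 < \<alpha>"
  shows "\<exists>C>0. \<forall>s. 1 \<le> \<alpha> * s \<longrightarrow> scaled_bessel_K \<alpha> \<nu> (s\<^sup>2) \<le> C * (s powr (\<nu> - 1/2) * exp (- \<alpha> * s))"
proof (intro exI conjI allI impI)
  define C where "C = sqrt (4 * pi / \<alpha>) * exp (\<nu>\<^sup>2)"
  show "0 < C" using a by (simp add: C_def)
  fix s :: real assume z: "1 \<le> \<alpha> * s"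
  then have s: "0 < s" using a by (metis less_le_trans zero_less_mult_pos zero_less_one)
  define z where "z = \<alpha> * s"
  have z0: "0 < z" "1 \<le> z" using z by (auto simp: z_def)
  have g: "has_bochner_integral lborel (\<lambda>x. exp (- z) * exp (\<nu> * x - z / 4 * x\<^sup>2))
     (exp (- z) * (sqrt (pi / (z / 4)) * exp (\<nu>\<^sup>2 / (4 * (z / 4)))))"
    by (rule has_bochner_integral_mult_right[OF gaussian_integral_real]) (use z0 in auto)
  have "(LINT t|lborel. exp (\<nu> * t - z * cosh t)) \<le> (LINT t|lborel. exp (- z) * exp (\<nu> * t - z / 4 * t\<^sup>2))"
  proof (rule integral_mono)
    fix t :: real
    have "z * (1 + t\<^sup>2 / 4) \<le> z * cosh t" using cosh_ge_quadratic z0 by simp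
    then show "exp (\<nu> * t - z * cosh t) \<le> exp (- z) * exp (\<nu> * t - z / 4 * t\<^sup>2)"
      by (simp add: exp_add[symmetric] algebra_simps)
  qed (use integrable_exp_cosh[OF z0(1)] g in \<open>auto simp: has_bochner_integral_iff\<close>)
  also have "\<dots> = exp (- z) * (sqrt (4 * pi / z) * exp (\<nu>\<^sup>2 / z))"
    using has_bochner_integral_integral_eq[OF g] by (simp add: mult.commute)
  also have "\<dots> \<le> exp (- z) * (sqrt (4 * pi / z) * exp (\<nu>\<^sup>2))"
    using z0 by (intro mult_left_mono) (auto simp: divide_le_eq mult_left_mono[of 1 z "\<nu>\<^sup>2", simplified])
  also have "\<dots> = C * (s powr (- 1/2) * exp (- \<alpha> * s))"
    using s a by (simp add: C_def z_def powr_minus powr_half_sqrt real_sqrt_divide real_sqrt_mult field_simps)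
  finally have "s powr \<nu> * (LINT t|lborel. exp (\<nu> * t - z * cosh t)) \<le> s powr \<nu> * (C * (s powr (- 1/2) * exp (- \<alpha> * s)))"
    by (intro mult_left_mono) auto
  also have "\<dots> = C * (s powr (\<nu> - 1/2) * exp (- \<alpha> * s))"
    using powr_add[of s \<nu> "-1/2"] by simp
  finally show "scaled_bessel_K \<alpha> \<nu> (s\<^sup>2) \<le> C * (s powr (\<nu> - 1/2) * exp (- \<alpha> * s))"
    using s by (simp add: scaled_bessel_K_eq_exp_cosh z_def)
qed

text \<open>
  The integrand is of size \<open>exp (- \<alpha> s)\<close> on an interval of length \<open>1 / sqrt (\<alpha> s)\<close>; together with the
  upper bound this fixes the exact order at infinity.
\<close>

lemma scaled_bessel_K_lower:
  assumes a: "0 < \<alpha>"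
  shows "\<exists>c>0. \<forall>s. 1 \<le> \<alpha> * s \<longrightarrow> c * (s powr (\<nu> - 1/2) * exp (- \<alpha> * s)) \<le> scaled_bessel_K \<alpha> \<nu> (s\<^sup>2)"
proof (intro exI conjI allI impI)
  define c where "c = exp (- \<bar>\<nu>\<bar> - 1) / sqrt \<alpha>"
  show "0 < c" using a by (simp add: c_def)
  fix s :: real assume z: "1 \<le> \<alpha> * s"
  then have s: "0 < s" using a by (metis less_le_trans zero_less_mult_pos zero_less_one)
  define z where "z = \<alpha> * s"
  have z0: "0 < z" "1 \<le> z" using z by (auto simp: z_def)
  have "c * (s powr (- 1/2) * exp (- \<alpha> * s)) = exp (- \<bar>\<nu>\<bar> - 1 - z) * (1 / sqrt z)"
    using s a by (simp add: c_def z_def powr_minus powr_half_sqrt real_sqrt_mult exp_diff exp_minus exp_add field_simps)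
  also have "\<dots> = (LINT t|lborel. indicator {0..1 / sqrt z} t * exp (- \<bar>\<nu>\<bar> - 1 - z))"
    using z0 by simp
  also have "\<dots> \<le> (LINT t|lborel. exp (\<nu> * t - z * cosh t))"
  proof (rule integral_mono)
    fix t :: real
    show "indicator {0..1 / sqrt z} t * exp (- \<bar>\<nu>\<bar> - 1 - z) \<le> exp (\<nu> * t - z * cosh t)"
    proof (cases "t \<in> {0..1 / sqrt z}")
      case True
      have "1 / sqrt z \<le> 1" using z0 by simp
      then have t: "0 \<le> t" "t \<le> 1" "t \<le> 1 / sqrt z" using True by auto
      have "t\<^sup>2 \<le> (1 / sqrt z)\<^sup>2" using t by (intro power_mono) auto
      then have "z * t\<^sup>2 \<le> 1" using z0 by (simp add: power_divide field_simps)
      moreover have "z * cosh t \<le> z * (1 + t\<^sup>2)" using cosh_le_quadratic[OF t(1,2)] z0 by simp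
      moreover have "- \<bar>\<nu>\<bar> \<le> \<nu> * t"
      proof -
        have "\<bar>\<nu> * t\<bar> \<le> \<bar>\<nu>\<bar> * 1" unfolding abs_mult using t by (intro mult_left_mono) auto
        then show ?thesis by linarith
      qed
      ultimately have "- \<bar>\<nu>\<bar> - 1 - z \<le> \<nu> * t - z * cosh t" by (simp add: distrib_left)
      then show ?thesis using True by simp
    qed simp
  qed (use integrable_exp_cosh[OF z0(1)] in \<open>auto simp: integrable_indicator_iff emeasure_lborel_Icc_eq\<close>)
  finally have "s powr \<nu> * (c * (s powr (- 1/2) * exp (- \<alpha> * s))) \<le> s powr \<nu> * (LINT t|lborel. exp (\<nu> * t - z * cosh t))"
    by (intro mult_left_mono) auto
  moreover have "s powr \<nu> * (c * (s powr (- 1/2) * exp (- \<alpha> * s))) = c * (s powr (\<nu> - 1/2) * exp (- \<alpha> * s))"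
    using powr_add[of s \<nu> "-1/2"] by simp
  ultimately show "c * (s powr (\<nu> - 1/2) * exp (- \<alpha> * s)) \<le> scaled_bessel_K \<alpha> \<nu> (s\<^sup>2)"
    unfolding scaled_bessel_K_eq_exp_cosh[OF s] z_def[symmetric] by (simp only:)
qed

section \<open>The rescaled Bessel function: derivative and recurrence\<close>

text \<open>
  Differentiation under the integral sign.  For increments below y / 2 the difference quotients are
  dominated by the integrand of order \<open>\<nu> - 1\<close> at y / 2.
\<close>

lemma has_derivative_scaled_bessel_K:
  assumes a: "0 < \<alpha>" and y: "0 < y"
  shows "(scaled_bessel_K \<alpha> \<nu> has_real_derivative - (\<alpha> / 2) * scaled_bessel_K \<alpha> (\<nu> - 1) y) (at y)"
proof -
  define k where "k h u = exp (\<nu> * u - \<alpha> / 2 * exp u - \<alpha> / 2 * (y + h) * exp (- u))" for h u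
  define D where "D u = - (\<alpha> / 2) * exp ((\<nu> - 1) * u - \<alpha> / 2 * exp u - \<alpha> / 2 * y * exp (- u))" for u
  define w where "w u = \<alpha> / 2 * exp ((\<nu> - 1) * u - \<alpha> / 2 * exp u - \<alpha> / 2 * (y / 2) * exp (- u))" for u
  have kint: "integrable lborel (k h)" if "h \<in> {-(y/2)<..<y/2}" for h
    unfolding k_def[abs_def] using integrable_scaled_bessel_K[OF a, of "y + h" \<nu>] that by simp
  have exp_le: "\<bar>exp (- p) - exp (- q)\<bar> \<le> \<bar>p - q\<bar> * exp (- r)" if "r \<le> p" "r \<le> q" for p q r :: real
  proof -
    have *: "exp (- p) - exp (- q) \<le> (q - p) * exp (- r)" if "p \<le> q" "r \<le> p" for p q
    proof -
      have "exp (- p) - exp (- q) = exp (- p) * (1 - exp (- (q - p)))"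
        by (simp add: algebra_simps exp_add[symmetric])
      also have "\<dots> \<le> exp (- r) * (q - p)"
        using that exp_ge_add_one_self[of "- (q - p)"]
        by (intro mult_mono) (auto simp: algebra_simps)
      finally show ?thesis by (simp add: mult.commute)
    qed
    show ?thesis using *[of p q] *[of q p] that by (cases "p \<le> q") (auto simp: abs_if)
  qed
  have bound: "\<bar>(k h u - k 0 u) / h\<bar> \<le> w u" if h: "h \<in> {-(y/2)<..<y/2} - {0}" for h u
  proof -
    have "\<bar>exp (- (\<alpha> / 2 * (y + h) * exp (- u))) - exp (- (\<alpha> / 2 * y * exp (- u)))\<bar>
        \<le> \<bar>\<alpha> / 2 * (y + h) * exp (- u) - \<alpha> / 2 * y * exp (- u)\<bar> * exp (- (\<alpha> / 2 * (y / 2) * exp (- u)))"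
      using a y h by (intro exp_le) auto
    also have "\<bar>\<alpha> / 2 * (y + h) * exp (- u) - \<alpha> / 2 * y * exp (- u)\<bar> = \<bar>h\<bar> * (\<alpha> / 2 * exp (- u))"
    proof -
      have "\<alpha> / 2 * (y + h) * exp (- u) - \<alpha> / 2 * y * exp (- u) = h * (\<alpha> / 2 * exp (- u))"
        by (simp add: algebra_simps)
      then show ?thesis using a by (simp only: abs_mult) simp
    qed
    finally have "exp (\<nu> * u - \<alpha> / 2 * exp u) * \<bar>exp (- (\<alpha> / 2 * (y + h) * exp (- u))) - exp (- (\<alpha> / 2 * y * exp (- u)))\<bar>
       \<le> exp (\<nu> * u - \<alpha> / 2 * exp u) * (\<bar>h\<bar> * (\<alpha> / 2 * exp (- u)) * exp (- (\<alpha> / 2 * (y / 2) * exp (- u))))"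
      by (rule mult_left_mono) simp
    also have "\<dots> = \<bar>h\<bar> * w u"
    proof -
      have "exp ((\<nu> - 1) * u - \<alpha> / 2 * exp u - \<alpha> / 2 * (y / 2) * exp (- u))
          = exp (\<nu> * u - \<alpha> / 2 * exp u) * exp (- u) * exp (- (\<alpha> / 2 * (y / 2) * exp (- u)))"
        unfolding exp_add[symmetric] by (simp add: algebra_simps)
      then show ?thesis unfolding w_def by simp
    qed
    also have "exp (\<nu> * u - \<alpha> / 2 * exp u) * \<bar>exp (- (\<alpha> / 2 * (y + h) * exp (- u))) - exp (- (\<alpha> / 2 * y * exp (- u)))\<bar>
       = \<bar>k h u - k 0 u\<bar>"
    proof -
      have "k h u = exp (\<nu> * u - \<alpha> / 2 * exp u) * exp (- (\<alpha> / 2 * (y + h) * exp (- u)))" for h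
        unfolding k_def exp_add[symmetric] by simp
      then show ?thesis by (simp add: abs_mult flip: right_diff_distrib)
    qed
    finally show ?thesis using h by (simp add: divide_le_eq mult.commute)
  qed
  have lim: "((\<lambda>h. (k h u - k 0 u) / h) \<longlongrightarrow> D u) (at 0)" for u
  proof -
    have "((\<lambda>h. k h u) has_real_derivative D u) (at 0)"
    proof -
      have "((\<lambda>h. k h u) has_real_derivative k 0 u * (- (\<alpha> / 2 * exp (- u)))) (at 0)"
        unfolding k_def by (auto intro!: derivative_eq_intros)
      moreover have "D u = - (\<alpha> / 2) * (k 0 u * exp (- u))"
        unfolding D_def k_def exp_add[symmetric] by (simp add: algebra_simps)
      ultimately show ?thesis by (simp add: mult_ac)
    qed
    then show ?thesis by (simp add: DERIV_def)
  qed
  have at0: "at 0 = at (0::real) within {-(y/2)<..<y/2}"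
    using y by (intro at_within_open[symmetric]) auto
  have "((\<lambda>h. LINT u|lborel. (k h u - k 0 u) / h) \<longlongrightarrow> (LINT u|lborel. D u)) (at 0)"
    unfolding at0 tendsto_at_iff_sequentially comp_def
  proof (intro allI impI)
    fix X assume X: "\<forall>i. X i \<in> {-(y/2)<..<y/2} - {0::real}" "X \<longlonglongrightarrow> 0"
    show "(\<lambda>i. LINT u|lborel. (k (X i) u - k 0 u) / X i) \<longlonglongrightarrow> (LINT u|lborel. D u)"
    proof (rule integral_dominated_convergence[where w=w])
      show "integrable lborel w"
        unfolding w_def[abs_def] using integrable_scaled_bessel_K[OF a, of "y / 2"] y by simp
      show "AE u in lborel. (\<lambda>i. (k (X i) u - k 0 u) / X i) \<longlonglongrightarrow> D u"
        using lim X unfolding tendsto_at_iff_sequentially comp_def by auto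
      show "AE u in lborel. norm ((k (X i) u - k 0 u) / X i) \<le> w u" for i
        using bound[of "X i"] X by auto
    qed (auto simp: D_def[abs_def] k_def[abs_def])
  qed
  then have "((\<lambda>h. (scaled_bessel_K \<alpha> \<nu> (y + h) - scaled_bessel_K \<alpha> \<nu> y) / h) \<longlongrightarrow> (LINT u|lborel. D u)) (at 0)"
  proof (rule Lim_transform_within_open)
    show "open {-(y/2)<..<y/2}" "0 \<in> {-(y/2)<..<y/2}" using y by auto
    fix h assume "h \<in> {-(y/2)<..<y/2}" "h \<noteq> 0"
    then show "(LINT u|lborel. (k h u - k 0 u) / h) = (scaled_bessel_K \<alpha> \<nu> (y + h) - scaled_bessel_K \<alpha> \<nu> y) / h"
    proof -
      have "scaled_bessel_K \<alpha> \<nu> (y + h) = (LINT u|lborel. k h u)" "scaled_bessel_K \<alpha> \<nu> y = (LINT u|lborel. k 0 u)"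
        by (simp_all add: scaled_bessel_K_def k_def)
      then show ?thesis using kint[of h] kint[of 0] y \<open>h \<in> _\<close> by simp
    qed
  qed
  moreover have "(LINT u|lborel. D u) = - (\<alpha> / 2) * scaled_bessel_K \<alpha> (\<nu> - 1) y"
    unfolding D_def scaled_bessel_K_def by simp
  ultimately show ?thesis unfolding DERIV_def by simp
qed

text \<open>
  The derivative of the integrand with respect to u integrates to zero over the line.
\<close>

lemma scaled_bessel_K_recurrence:
  assumes a: "0 < \<alpha>" and y: "0 < y"
  shows "2 * \<nu> * scaled_bessel_K \<alpha> \<nu> y + \<alpha> * y * scaled_bessel_K \<alpha> (\<nu> - 1) y = \<alpha> * scaled_bessel_K \<alpha> (\<nu> + 1) y"
proof -
  define k where "k \<mu> u = exp (\<mu> * u - \<alpha> / 2 * exp u - \<alpha> / 2 * y * exp (- u))" for \<mu> u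
  have k: "integrable lborel (k \<mu>)" for \<mu>
    unfolding k_def[abs_def] by (rule integrable_scaled_bessel_K[OF a y])
  define k' where "k' u = \<nu> * k \<nu> u - \<alpha> / 2 * k (\<nu> + 1) u + \<alpha> / 2 * y * k (\<nu> - 1) u" for u
  have D: "(k \<nu> has_real_derivative k' u) (at u)" for u
  proof -
    have shift: "k (\<nu> + 1) u = exp u * k \<nu> u" "k (\<nu> - 1) u = exp (- u) * k \<nu> u"
      unfolding k_def exp_add[symmetric] by (simp_all add: algebra_simps)
    have "(k \<nu> has_real_derivative (\<nu> - \<alpha> / 2 * exp u + \<alpha> / 2 * y * exp (- u)) * k \<nu> u) (at u)"
      unfolding k_def[abs_def] by (auto intro!: derivative_eq_intros)
    then show ?thesis unfolding k'_def shift by (simp add: algebra_simps)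
  qed
  have "(LBINT u=-\<infinity>..\<infinity>. k' u) = 0 - 0"
  proof (rule interval_integral_FTC_integrable)
    show "(k \<nu> has_vector_derivative k' u) (at u)" for u
      using D by (simp add: has_real_derivative_iff_has_vector_derivative)
    show "isCont k' u" for u unfolding k'_def k_def by (intro continuous_intros)
    show "set_integrable lborel (einterval (- \<infinity>) \<infinity>) k'"
      unfolding k'_def[abs_def] set_integrable_def using k by simp
    have bot: "((\<lambda>u. exp (\<nu> * u - p * exp u - c * exp (- u))) \<longlongrightarrow> 0) at_bot"
      and top: "((\<lambda>u. exp (\<nu> * u - p * exp u - c * exp (- u))) \<longlongrightarrow> 0) at_top"
      if "0 < p" "0 < c" for p c :: real
      using that by real_asymp+
    show "((k \<nu> \<circ> real_of_ereal) \<longlongrightarrow> 0) (at_right (- \<infinity>))"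
      unfolding ereal_tendsto_simps k_def using bot[of "\<alpha> / 2" "\<alpha> / 2 * y"] a y by simp
    show "((k \<nu> \<circ> real_of_ereal) \<longlongrightarrow> 0) (at_left \<infinity>)"
      unfolding ereal_tendsto_simps k_def using top[of "\<alpha> / 2" "\<alpha> / 2 * y"] a y by simp
  qed simp
  then have "(LINT u|lborel. k' u) = 0"
    by (simp add: interval_lebesgue_integral_def set_lebesgue_integral_def)
  moreover have "(LINT u|lborel. k' u) = \<nu> * scaled_bessel_K \<alpha> \<nu> y - \<alpha> / 2 * scaled_bessel_K \<alpha> (\<nu> + 1) y + \<alpha> / 2 * y * scaled_bessel_K \<alpha> (\<nu> - 1) y"
    unfolding k'_def scaled_bessel_K_def k_def[symmetric] using k by simp
  ultimately show ?thesis by simp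
qed

lemma has_derivative_scaled_bessel_K_radial:
  assumes "0 < \<alpha>" "0 < \<delta>"
  shows "((\<lambda>x. scaled_bessel_K \<alpha> \<nu> (x\<^sup>2 + \<delta>\<^sup>2)) has_real_derivative - \<alpha> * x * scaled_bessel_K \<alpha> (\<nu> - 1) (x\<^sup>2 + \<delta>\<^sup>2)) (at x)"
proof -
  have d: "((\<lambda>x. x\<^sup>2 + \<delta>\<^sup>2) has_real_derivative 2 * x) (at x)"
    by (auto intro!: derivative_eq_intros)
  have "0 < x\<^sup>2 + \<delta>\<^sup>2" using assms by (simp add: add_nonneg_pos)
  from DERIV_chain2[where g="\<lambda>x. x\<^sup>2 + \<delta>\<^sup>2" and x=x, OF has_derivative_scaled_bessel_K[OF assms(1) this] d]
  show ?thesis by (simp add: mult_ac)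
qed

lemma continuous_on_scaled_bessel_K_radial:
  assumes "0 < \<alpha>" "0 < \<delta>"
  shows "continuous_on A (\<lambda>x. scaled_bessel_K \<alpha> \<nu> (x\<^sup>2 + \<delta>\<^sup>2))"
  by (rule continuous_at_imp_continuous_on) (use has_derivative_scaled_bessel_K_radial[OF assms] DERIV_isCont in blast)

lemma scaled_bessel_K_radial_pos:
  assumes "0 < \<alpha>" "0 < \<delta>"
  shows "0 < scaled_bessel_K \<alpha> \<nu> (x\<^sup>2 + \<delta>\<^sup>2)"
  using assms by (intro scaled_bessel_K_pos) (auto simp: add_nonneg_pos)

section \<open>Normalisation of the generalised hyperbolic density\<close>

text \<open>
  Integrating in x first leaves a Gaussian integral.  It completes the exponent of the outer
  integrand to one of the same double exponential form with order \<open>\<nu> + 1/2\<close> and with \<open>\<alpha>\<close> and y replaced by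
  \<open>\<gamma>\<^sup>2 / \<alpha>\<close> and \<open>(\<alpha> \<delta> / \<gamma>)\<^sup>2\<close>.
\<close>

lemma gh_normalisation:
  fixes \<alpha> \<beta> \<delta> \<nu> :: real
  assumes d: "0 < \<delta>" and b: "\<bar>\<beta>\<bar> < \<alpha>"
  defines "\<gamma> \<equiv> sqrt (\<alpha>\<^sup>2 - \<beta>\<^sup>2)"
  shows "(\<integral>\<^sup>+x. ennreal (exp (\<beta> * x) * scaled_bessel_K \<alpha> \<nu> (x\<^sup>2 + \<delta>\<^sup>2)) \<partial>lborel)
     = ennreal (2 * sqrt (2 * pi / \<alpha>) * (\<alpha> * \<delta> / \<gamma>) powr (\<nu> + 1/2) * bessel_K (\<nu> + 1/2) (\<delta> * \<gamma>))"
proof -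
  have a: "0 < \<alpha>" using b by simp
  have "\<beta>\<^sup>2 < \<alpha>\<^sup>2" using b by (metis abs_ge_zero power2_abs power2_strict_mono abs_of_pos a abs_less_iff)
  then have g: "0 < \<gamma>" and g2: "\<gamma>\<^sup>2 = \<alpha>\<^sup>2 - \<beta>\<^sup>2" by (auto simp: \<gamma>_def)
  define k where "k x u = exp (\<beta> * x) * exp (\<nu> * u - \<alpha> / 2 * exp u - \<alpha> / 2 * (x\<^sup>2 + \<delta>\<^sup>2) * exp (- u))" for x u
  define r where "r u = exp ((\<nu> + 1/2) * u - (\<gamma>\<^sup>2 / \<alpha>) / 2 * exp u - (\<gamma>\<^sup>2 / \<alpha>) / 2 * (\<alpha> * \<delta> / \<gamma>)\<^sup>2 * exp (- u))" for u
  have yp: "0 < x\<^sup>2 + \<delta>\<^sup>2" for x using d by (simp add: add_nonneg_pos)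
  have [measurable]: "(\<lambda>(x, u). ennreal (k x u)) \<in> borel_measurable (lborel \<Otimes>\<^sub>M lborel)"
    unfolding k_def[abs_def] by measurable
  have inner_u: "(\<integral>\<^sup>+u. ennreal (k x u) \<partial>lborel) = ennreal (exp (\<beta> * x) * scaled_bessel_K \<alpha> \<nu> (x\<^sup>2 + \<delta>\<^sup>2))" for x
    unfolding k_def scaled_bessel_K_def using integrable_scaled_bessel_K[OF a yp[of x], of \<nu>]
    by (subst nn_integral_eq_integral) auto
  have inner_x: "(\<integral>\<^sup>+x. ennreal (k x u) \<partial>lborel) = ennreal (sqrt (2 * pi / \<alpha>) * r u)" for u
  proof -
    define A where "A = exp (\<nu> * u - \<alpha> / 2 * exp u - \<alpha> / 2 * \<delta>\<^sup>2 * exp (- u))"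
    define m where "m = \<alpha> / 2 * exp (- u)"
    have m: "0 < m" using a by (simp add: m_def)
    have "k x u = A * exp (\<beta> * x - m * x\<^sup>2)" for x
      unfolding k_def A_def m_def exp_add[symmetric] by (simp add: algebra_simps)
    then have "has_bochner_integral lborel (\<lambda>x. k x u) (A * (sqrt (pi / m) * exp (\<beta>\<^sup>2 / (4 * m))))"
      using has_bochner_integral_mult_right[OF gaussian_integral_real[OF m, of \<beta>], of A] by simp
    moreover have "A * (sqrt (pi / m) * exp (\<beta>\<^sup>2 / (4 * m))) = sqrt (2 * pi / \<alpha>) * r u"
    proof -
      have "pi / m = 2 * pi / \<alpha> * (exp (u / 2))\<^sup>2"
        using a by (simp add: m_def exp_minus field_simps flip: exp_double)
      then have s: "sqrt (pi / m) = sqrt (2 * pi / \<alpha>) * exp (u / 2)"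
        by (simp only: real_sqrt_mult) simp
      have "\<beta>\<^sup>2 / (4 * m) = (\<alpha>\<^sup>2 - \<gamma>\<^sup>2) / (2 * \<alpha>) * exp u"
        unfolding g2 m_def using a by (simp add: exp_minus field_simps)
      also have "\<dots> = \<alpha> / 2 * exp u - (\<gamma>\<^sup>2 / \<alpha>) / 2 * exp u"
        using a by (simp add: field_simps power2_eq_square)
      finally have e: "\<beta>\<^sup>2 / (4 * m) = \<alpha> / 2 * exp u - (\<gamma>\<^sup>2 / \<alpha>) / 2 * exp u" .
      have c: "(\<gamma>\<^sup>2 / \<alpha>) / 2 * (\<alpha> * \<delta> / \<gamma>)\<^sup>2 = \<alpha> / 2 * \<delta>\<^sup>2"
        using a g by (simp add: field_simps power2_eq_square)
      have "A * (exp (u / 2) * exp (\<beta>\<^sup>2 / (4 * m))) = r u"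
        unfolding A_def r_def e c exp_add[symmetric] by (simp add: algebra_simps)
      then show ?thesis unfolding s by (simp add: mult_ac)
    qed
    ultimately show ?thesis
      by (subst nn_integral_eq_integral) (auto simp: has_bochner_integral_iff k_def)
  qed
  have "(\<integral>\<^sup>+x. ennreal (exp (\<beta> * x) * scaled_bessel_K \<alpha> \<nu> (x\<^sup>2 + \<delta>\<^sup>2)) \<partial>lborel)
      = (\<integral>\<^sup>+x. (\<integral>\<^sup>+u. ennreal (k x u) \<partial>lborel) \<partial>lborel)"
    by (simp add: inner_u)
  also have "\<dots> = (\<integral>\<^sup>+u. (\<integral>\<^sup>+x. ennreal (k x u) \<partial>lborel) \<partial>lborel)"
    by (rule lborel_pair.Fubini'[symmetric]) measurable
  also have "\<dots> = (\<integral>\<^sup>+u. ennreal (sqrt (2 * pi / \<alpha>) * r u) \<partial>lborel)"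
    by (simp add: inner_x)
  also have "\<dots> = ennreal (sqrt (2 * pi / \<alpha>) * scaled_bessel_K (\<gamma>\<^sup>2 / \<alpha>) (\<nu> + 1/2) ((\<alpha> * \<delta> / \<gamma>)\<^sup>2))"
  proof -
    have "integrable lborel r" unfolding r_def[abs_def]
      by (rule integrable_scaled_bessel_K) (use a d g in auto)
    moreover have "(LINT u|lborel. r u) = scaled_bessel_K (\<gamma>\<^sup>2 / \<alpha>) (\<nu> + 1/2) ((\<alpha> * \<delta> / \<gamma>)\<^sup>2)"
      unfolding scaled_bessel_K_def r_def ..
    moreover have "0 \<le> sqrt (2 * pi / \<alpha>) * r u" for u using a by (simp add: r_def)
    ultimately show ?thesis
      using nn_integral_eq_integral[of lborel "\<lambda>u. sqrt (2 * pi / \<alpha>) * r u"] by simp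
  qed
  also have "scaled_bessel_K (\<gamma>\<^sup>2 / \<alpha>) (\<nu> + 1/2) ((\<alpha> * \<delta> / \<gamma>)\<^sup>2)
      = 2 * (\<alpha> * \<delta> / \<gamma>) powr (\<nu> + 1/2) * bessel_K (\<nu> + 1/2) (\<gamma>\<^sup>2 / \<alpha> * (\<alpha> * \<delta> / \<gamma>))"
    using a d g by (intro scaled_bessel_K_eq_bessel_K) auto
  also have "\<gamma>\<^sup>2 / \<alpha> * (\<alpha> * \<delta> / \<gamma>) = \<delta> * \<gamma>"
    using a g by (simp add: field_simps power2_eq_square)
  finally show ?thesis by (simp add: mult_ac)
qed

text \<open>
  Half of the constant in \<open>gh_density\<close>; the factor 1/2 compensates the factor 2 between
  \<open>scaled_bessel_K\<close> and \<open>bessel_K\<close>.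
\<close>

definition gh_const :: "real \<Rightarrow> real \<Rightarrow> real \<Rightarrow> real \<Rightarrow> real" where
  "gh_const lam \<alpha> \<beta> \<delta> = (\<alpha>\<^sup>2 - \<beta>\<^sup>2) powr (lam / 2)
     / (2 * sqrt (2 * pi) * \<alpha> powr (lam - 1/2) * \<delta> powr lam * bessel_K lam (\<delta> * sqrt (\<alpha>\<^sup>2 - \<beta>\<^sup>2)))"

lemma bessel_K_pos: "0 < z \<Longrightarrow> 0 < bessel_K \<nu> z"
  using scaled_bessel_K_eq_bessel_K[of 1 z \<nu>] scaled_bessel_K_pos[of 1 "z\<^sup>2" \<nu>] by (simp add: zero_less_mult_iff)

lemma gh_const_pos:
  assumes d: "0 < \<delta>" and b: "\<bar>\<beta>\<bar> < \<alpha>"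
  shows "0 < gh_const lam \<alpha> \<beta> \<delta>"
proof -
  have "\<bar>\<beta>\<bar>\<^sup>2 < \<alpha>\<^sup>2" using b by (intro power_strict_mono) auto
  then have "0 < sqrt (\<alpha>\<^sup>2 - \<beta>\<^sup>2)" by simp
  with bessel_K_pos[of "\<delta> * sqrt (\<alpha>\<^sup>2 - \<beta>\<^sup>2)" lam] d b show ?thesis
    unfolding gh_const_def by (intro divide_pos_pos mult_pos_pos) auto
qed

lemma gh_density_eq_scaled_bessel_K:
  assumes d: "0 < \<delta>" and b: "\<bar>\<beta>\<bar> < \<alpha>"
  shows "gh_density lam \<alpha> \<beta> \<delta> x = gh_const lam \<alpha> \<beta> \<delta> * exp (\<beta> * x) * scaled_bessel_K \<alpha> (lam - 1/2) (x\<^sup>2 + \<delta>\<^sup>2)"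
proof -
  have yp: "0 < x\<^sup>2 + \<delta>\<^sup>2" using d by (simp add: add_nonneg_pos)
  define s where "s = sqrt (x\<^sup>2 + \<delta>\<^sup>2)"
  have s: "0 < s" "s\<^sup>2 = x\<^sup>2 + \<delta>\<^sup>2" using yp by (auto simp: s_def)
  have "(x\<^sup>2 + \<delta>\<^sup>2) powr ((lam - 1/2) / 2) = s powr (lam - 1/2)"
    unfolding s_def using yp by (simp add: powr_half_sqrt[symmetric] powr_powr)
  then show ?thesis
    using scaled_bessel_K_eq_bessel_K[of \<alpha> s "lam - 1/2"] b s
    unfolding gh_density_def gh_const_def add.commute[of "\<delta>\<^sup>2"] s_def[symmetric] by simp
qed

lemma prob_space_gh_measure:
  assumes d: "0 < \<delta>" and b: "\<bar>\<beta>\<bar> < \<alpha>"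
  shows "prob_space (gh_measure lam \<alpha> \<beta> \<delta>)"
proof
  define \<gamma> where "\<gamma> = sqrt (\<alpha>\<^sup>2 - \<beta>\<^sup>2)"
  define c where "c = gh_const lam \<alpha> \<beta> \<delta>"
  have a: "0 < \<alpha>" using b by simp
  have "\<bar>\<beta>\<bar>\<^sup>2 < \<alpha>\<^sup>2" using b by (intro power_strict_mono) auto
  then have g: "0 < \<gamma>" and g': "(\<alpha>\<^sup>2 - \<beta>\<^sup>2) powr (lam / 2) = \<gamma> powr lam"
    by (auto simp: \<gamma>_def powr_half_sqrt[symmetric] powr_powr)
  have K: "0 < bessel_K lam (\<delta> * \<gamma>)" using bessel_K_pos d g by simp
  have c0: "0 \<le> c" using gh_const_pos[OF d b, of lam] by (simp add: c_def)
  have [measurable]: "(\<lambda>x. scaled_bessel_K \<alpha> (lam - 1/2) (x\<^sup>2 + \<delta>\<^sup>2)) \<in> borel_measurable borel"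
    using borel_measurable_continuous_onI[OF continuous_on_scaled_bessel_K_radial[OF a d]] .
  have "emeasure (gh_measure lam \<alpha> \<beta> \<delta>) UNIV
      = (\<integral>\<^sup>+x. ennreal c * ennreal (exp (\<beta> * x) * scaled_bessel_K \<alpha> (lam - 1/2) (x\<^sup>2 + \<delta>\<^sup>2)) \<partial>lborel)"
    unfolding gh_measure_def gh_density_eq_scaled_bessel_K[OF d b] c_def[symmetric]
    by (subst emeasure_density) (use c0 in \<open>auto simp: ennreal_mult'[symmetric] mult.assoc\<close>)
  also have "\<dots> = ennreal c * ennreal (2 * sqrt (2 * pi / \<alpha>) * (\<alpha> * \<delta> / \<gamma>) powr lam * bessel_K lam (\<delta> * \<gamma>))"
    using gh_normalisation[OF d b, of "lam - 1/2"] by (subst nn_integral_cmult) (auto simp: \<gamma>_def)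
  also have "\<dots> = ennreal (c * (2 * sqrt (2 * pi / \<alpha>) * (\<alpha> * \<delta> / \<gamma>) powr lam * bessel_K lam (\<delta> * \<gamma>)))"
    using c0 by (simp add: ennreal_mult'[symmetric])
  also have "c * (2 * sqrt (2 * pi / \<alpha>) * (\<alpha> * \<delta> / \<gamma>) powr lam * bessel_K lam (\<delta> * \<gamma>)) = 1"
  proof -
    have "(\<alpha> * \<delta> / \<gamma>) powr lam = \<alpha> powr lam * \<delta> powr lam / \<gamma> powr lam"
      using a d g by (simp add: powr_mult powr_divide)
    moreover have "\<alpha> powr (lam - 1/2) = \<alpha> powr lam / sqrt \<alpha>"
      using a by (simp add: powr_diff powr_half_sqrt)
    ultimately show ?thesis
      using a d g K unfolding c_def gh_const_def \<gamma>_def[symmetric] g'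
      by (simp add: real_sqrt_divide real_sqrt_mult field_simps)
  qed
  finally show "emeasure (gh_measure lam \<alpha> \<beta> \<delta>) (space (gh_measure lam \<alpha> \<beta> \<delta>)) = 1"
    by (simp add: gh_measure_def)
qed

section \<open>The Stein operator as a derivative\<close>

text \<open>
  The expressions multiplied by the coefficients on the right are the derivatives of order 2, 1 and 0
  of \<open>exp (\<beta> x) f x\<close>: in terms of that function the operator no longer involves \<open>\<beta>\<close>.
\<close>

lemma gh_stein_op_conjugate:
  assumes x: "x \<noteq> 0"
    and f: "\<And>x. (f has_real_derivative f1 x) (at x)" and f1: "(f1 has_real_derivative f2) (at x)"
  shows "exp (\<beta> * x) * gh_stein_op lam \<alpha> \<beta> \<delta> f x =
     (x\<^sup>2 + \<delta>\<^sup>2) / x * (exp (\<beta> * x) * (f2 + 2 * \<beta> * f1 x + \<beta>\<^sup>2 * f x))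
     + (2 * lam - \<delta>\<^sup>2 / x\<^sup>2) * (exp (\<beta> * x) * (f1 x + \<beta> * f x))
     - \<alpha>\<^sup>2 * x * (exp (\<beta> * x) * f x)"
proof -
  have "deriv f = f1" using DERIV_imp_deriv[OF f] by auto
  moreover have "deriv f1 x = f2" using DERIV_imp_deriv[OF f1] .
  ultimately show ?thesis
    unfolding gh_stein_op_def using x by (simp add: field_simps power2_eq_square)
qed

text \<open>
  The boundary term of the integration by parts of the operator against the density, with
  \<open>g1\<close> in the role of the derivative of \<open>g\<close>.
\<close>

definition stein_flux :: "real \<Rightarrow> real \<Rightarrow> real \<Rightarrow> (real \<Rightarrow> real) \<Rightarrow> (real \<Rightarrow> real) \<Rightarrow> real \<Rightarrow> real" where
  "stein_flux lam \<alpha> \<delta> g g1 x =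
     scaled_bessel_K \<alpha> (lam - 1/2) (x\<^sup>2 + \<delta>\<^sup>2) * ((x\<^sup>2 + \<delta>\<^sup>2) / x) * g1 x + \<alpha> * scaled_bessel_K \<alpha> (lam + 1/2) (x\<^sup>2 + \<delta>\<^sup>2) * g x"

text \<open>
  The terms in \<open>g1\<close> combine to the coefficient \<open>2 lam - \<delta>\<^sup>2 / x\<^sup>2\<close> exactly because of the three-term
  recurrence at order \<open>lam - 1/2\<close>.
\<close>

lemma has_derivative_stein_flux:
  assumes a: "0 < \<alpha>" and d: "0 < \<delta>" and x: "x \<noteq> 0"
    and g: "(g has_real_derivative g1 x) (at x)" and g1: "(g1 has_real_derivative g2) (at x)"
  shows "(stein_flux lam \<alpha> \<delta> g g1 has_real_derivative
     scaled_bessel_K \<alpha> (lam - 1/2) (x\<^sup>2 + \<delta>\<^sup>2) *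
       ((x\<^sup>2 + \<delta>\<^sup>2) / x * g2 + (2 * lam - \<delta>\<^sup>2 / x\<^sup>2) * g1 x - \<alpha>\<^sup>2 * x * g x)) (at x)"
proof -
  define y where "y = x\<^sup>2 + \<delta>\<^sup>2"
  have y: "0 < y" using d by (simp add: y_def add_nonneg_pos)
  define H where "H \<nu> = scaled_bessel_K \<alpha> \<nu> y" for \<nu>
  have rec: "\<alpha> * H (lam + 1/2) = (2 * lam - 1) * H (lam - 1/2) + \<alpha> * y * H (lam - 3/2)"
  proof -
    have e: "lam - 1/2 + 1 = lam + 1/2" "lam - 1/2 - 1 = lam - 3/2" "2 * (lam - 1/2) = 2 * lam - 1" by auto
    show ?thesis using scaled_bessel_K_recurrence[OF a y, of "lam - 1/2"] unfolding e H_def ..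
  qed
  have q: "((\<lambda>x. scaled_bessel_K \<alpha> \<nu> (x\<^sup>2 + \<delta>\<^sup>2)) has_real_derivative - \<alpha> * x * H (\<nu> - 1)) (at x)" for \<nu>
    using has_derivative_scaled_bessel_K_radial[OF a d] unfolding H_def y_def .
  have w: "((\<lambda>x. (x\<^sup>2 + \<delta>\<^sup>2) / x) has_real_derivative 1 - \<delta>\<^sup>2 / x\<^sup>2) (at x)"
    using x by (auto intro!: derivative_eq_intros simp: field_simps power2_eq_square)
  have "((\<lambda>x. scaled_bessel_K \<alpha> (lam - 1/2) (x\<^sup>2 + \<delta>\<^sup>2) * ((x\<^sup>2 + \<delta>\<^sup>2) / x) * g1 x + \<alpha> * scaled_bessel_K \<alpha> (lam + 1/2) (x\<^sup>2 + \<delta>\<^sup>2) * g x)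
    has_real_derivative
      (H (lam - 1/2) * (y / x)) * g2 + (H (lam - 1/2) * (1 - \<delta>\<^sup>2 / x\<^sup>2) + (- \<alpha> * x * H (lam - 1/2 - 1)) * (y / x)) * g1 x
      + (\<alpha> * H (lam + 1/2) * g1 x + \<alpha> * (- \<alpha> * x * H (lam + 1/2 - 1)) * g x)) (at x)"
    by (rule DERIV_cong[OF DERIV_add[OF DERIV_mult[OF DERIV_mult[OF q w] g1] DERIV_mult[OF DERIV_cmult[OF q] g]]])
      (simp add: H_def y_def algebra_simps)
  also have "(H (lam - 1/2) * (y / x)) * g2 + (H (lam - 1/2) * (1 - \<delta>\<^sup>2 / x\<^sup>2) + (- \<alpha> * x * H (lam - 1/2 - 1)) * (y / x)) * g1 x
      + (\<alpha> * H (lam + 1/2) * g1 x + \<alpha> * (- \<alpha> * x * H (lam + 1/2 - 1)) * g x)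
    = H (lam - 1/2) * (y / x * g2 + (2 * lam - \<delta>\<^sup>2 / x\<^sup>2) * g1 x - \<alpha>\<^sup>2 * x * g x)"
    unfolding rec using x by (simp add: field_simps power2_eq_square)
  finally show ?thesis unfolding stein_flux_def[abs_def] H_def y_def .
qed


section \<open>Behaviour of the flux at infinity and at the pole\<close>

definition gh_weight :: "real \<Rightarrow> real \<Rightarrow> real \<Rightarrow> real" where
  "gh_weight lam \<alpha> x = \<bar>x\<bar> powr lam * exp (- \<alpha> * \<bar>x\<bar>)"

text \<open>
  The weight of the growth conditions with \<open>\<bar>x\<bar>\<close> replaced by \<open>sqrt (x\<^sup>2 + \<delta>\<^sup>2)\<close>, the
  variable in which the Bessel functions are estimated.
\<close>

definition smooth_weight :: "real \<Rightarrow> real \<Rightarrow> real \<Rightarrow> real \<Rightarrow> real" where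
  "smooth_weight lam \<alpha> \<delta> x = sqrt (x\<^sup>2 + \<delta>\<^sup>2) powr lam * exp (- \<alpha> * sqrt (x\<^sup>2 + \<delta>\<^sup>2))"

lemma smooth_weight_pos: "0 < \<delta> \<Longrightarrow> 0 < smooth_weight lam \<alpha> \<delta> x"
proof -
  assume "0 < \<delta>"
  then have "x\<^sup>2 + \<delta>\<^sup>2 > 0" by (simp add: add_nonneg_pos)
  then show ?thesis unfolding smooth_weight_def by (metis exp_gt_zero less_irrefl mult_pos_pos powr_gt_zero real_sqrt_gt_zero)
qed

text \<open>
  Holds since \<open>sqrt (x\<^sup>2 + \<delta>\<^sup>2) - \<bar>x\<bar>\<close> tends to 0 and \<open>sqrt (x\<^sup>2 + \<delta>\<^sup>2) / \<bar>x\<bar>\<close> to 1.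
\<close>

lemma gh_weight_ratio:
  assumes a: "0 < \<alpha>" and d: "0 < \<delta>"
  shows "((\<lambda>x. gh_weight lam \<alpha> x / smooth_weight lam \<alpha> \<delta> x) \<longlongrightarrow> 1) at_infinity"
proof -
  let ?r = "\<lambda>x. gh_weight lam \<alpha> x / smooth_weight lam \<alpha> \<delta> x"
  have "(?r \<longlongrightarrow> 1) at_top" unfolding gh_weight_def smooth_weight_def using a d by real_asymp
  moreover from this have "(?r \<longlongrightarrow> 1) at_bot"
    unfolding filterlim_at_bot_mirror by (simp add: gh_weight_def smooth_weight_def)
  ultimately show ?thesis unfolding at_infinity_eq_at_top_bot by (rule filterlim_sup)
qed

lemma gh_weight_comparable:
  assumes a: "0 < \<alpha>" and d: "0 < \<delta>"
  shows "\<forall>\<^sub>F x in at_infinity. smooth_weight lam \<alpha> \<delta> x \<le> 2 * gh_weight lam \<alpha> x \<and> gh_weight lam \<alpha> x \<le> 2 * smooth_weight lam \<alpha> \<delta> x"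
  using order_tendstoD(1)[OF gh_weight_ratio[OF assms, of lam], of "1/2", simplified]
    order_tendstoD(2)[OF gh_weight_ratio[OF assms, of lam], of 2, simplified]
proof eventually_elim
  case (elim x)
  then show ?case using smooth_weight_pos[OF d, of lam \<alpha> x] by (simp add: field_simps)
qed

lemma sqrt_sum_squares_bounds:
  fixes x \<delta> :: real
  assumes "\<delta> \<le> \<bar>x\<bar>" "0 < \<delta>"
  shows "\<bar>x\<bar> \<le> sqrt (x\<^sup>2 + \<delta>\<^sup>2)" "sqrt (x\<^sup>2 + \<delta>\<^sup>2) \<le> 2 * \<bar>x\<bar>"
proof -
  show "\<bar>x\<bar> \<le> sqrt (x\<^sup>2 + \<delta>\<^sup>2)" by (intro real_le_rsqrt) auto
  have "\<delta>\<^sup>2 \<le> \<bar>x\<bar>\<^sup>2" using assms by (intro power_mono) auto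
  then have "x\<^sup>2 + \<delta>\<^sup>2 \<le> 4 * x\<^sup>2" unfolding power2_abs using zero_le_power2[of x] by linarith
  then show "sqrt (x\<^sup>2 + \<delta>\<^sup>2) \<le> 2 * \<bar>x\<bar>" by (intro real_le_lsqrt) (auto simp: power_mult_distrib)
qed

lemma eventually_abs_ge_at_infinity: "\<forall>\<^sub>F x in at_infinity. c \<le> \<bar>x :: real\<bar>"
  unfolding eventually_at_infinity by auto

text \<open>
  For the two orders in the flux, \<open>lam - 1/2\<close> and \<open>lam + 1/2\<close>, the power of the square root is
  -1 and 0 respectively.
\<close>

lemma scaled_bessel_K_comparable_weight:
  assumes a: "0 < \<alpha>" and d: "0 < \<delta>"
  shows "\<exists>c>0. \<forall>\<^sub>F x in at_infinity. c * (sqrt (x\<^sup>2 + \<delta>\<^sup>2) powr (\<nu> - 1/2 - lam) * smooth_weight lam \<alpha> \<delta> x) \<le> scaled_bessel_K \<alpha> \<nu> (x\<^sup>2 + \<delta>\<^sup>2)"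
    and "\<exists>C>0. \<forall>\<^sub>F x in at_infinity. scaled_bessel_K \<alpha> \<nu> (x\<^sup>2 + \<delta>\<^sup>2) \<le> C * (sqrt (x\<^sup>2 + \<delta>\<^sup>2) powr (\<nu> - 1/2 - lam) * smooth_weight lam \<alpha> \<delta> x)"
proof -
  obtain C where C: "0 < C" "\<And>s. 1 \<le> \<alpha> * s \<Longrightarrow> scaled_bessel_K \<alpha> \<nu> (s\<^sup>2) \<le> C * (s powr (\<nu> - 1/2) * exp (- \<alpha> * s))"
    using scaled_bessel_K_upper[OF a, of \<nu>] by blast
  obtain c where c: "0 < c" "\<And>s. 1 \<le> \<alpha> * s \<Longrightarrow> c * (s powr (\<nu> - 1/2) * exp (- \<alpha> * s)) \<le> scaled_bessel_K \<alpha> \<nu> (s\<^sup>2)"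
    using scaled_bessel_K_lower[OF a, of \<nu>] by blast
  have ev: "\<forall>\<^sub>F x in at_infinity. 1 \<le> \<alpha> * sqrt (x\<^sup>2 + \<delta>\<^sup>2)"
    using eventually_abs_ge_at_infinity[of "1 / \<alpha>"]
  proof eventually_elim
    case (elim x)
    have "\<bar>x\<bar> \<le> sqrt (x\<^sup>2 + \<delta>\<^sup>2)" by (intro real_le_rsqrt) auto
    then show ?case using elim a by (smt (verit) divide_le_eq mult.commute)
  qed
  have eq: "s powr (\<nu> - 1/2 - lam) * (s powr lam * exp (- \<alpha> * s)) = s powr (\<nu> - 1/2) * exp (- \<alpha> * s)" for s :: real
    by (simp add: powr_add[symmetric])
  have "\<forall>\<^sub>F x in at_infinity. c * (sqrt (x\<^sup>2 + \<delta>\<^sup>2) powr (\<nu> - 1/2 - lam) * smooth_weight lam \<alpha> \<delta> x) \<le> scaled_bessel_K \<alpha> \<nu> (x\<^sup>2 + \<delta>\<^sup>2)"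
    using ev
  proof eventually_elim
    case (elim x)
    from c(2)[OF elim] show ?case unfolding smooth_weight_def eq by simp
  qed
  with c(1) show "\<exists>c>0. \<forall>\<^sub>F x in at_infinity. c * (sqrt (x\<^sup>2 + \<delta>\<^sup>2) powr (\<nu> - 1/2 - lam) * smooth_weight lam \<alpha> \<delta> x) \<le> scaled_bessel_K \<alpha> \<nu> (x\<^sup>2 + \<delta>\<^sup>2)"
    by blast
  have "\<forall>\<^sub>F x in at_infinity. scaled_bessel_K \<alpha> \<nu> (x\<^sup>2 + \<delta>\<^sup>2) \<le> C * (sqrt (x\<^sup>2 + \<delta>\<^sup>2) powr (\<nu> - 1/2 - lam) * smooth_weight lam \<alpha> \<delta> x)"
    using ev
  proof eventually_elim
    case (elim x)
    from C(2)[OF elim] show ?case unfolding smooth_weight_def eq by simp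
  qed
  with C(1) show "\<exists>C>0. \<forall>\<^sub>F x in at_infinity. scaled_bessel_K \<alpha> \<nu> (x\<^sup>2 + \<delta>\<^sup>2) \<le> C * (sqrt (x\<^sup>2 + \<delta>\<^sup>2) powr (\<nu> - 1/2 - lam) * smooth_weight lam \<alpha> \<delta> x)"
    by blast
qed

lemma stein_flux_vanishes_at_infinity:
  assumes a: "0 < \<alpha>" and d: "0 < \<delta>"
    and g: "((\<lambda>x. gh_weight lam \<alpha> x * g x) \<longlongrightarrow> 0) at_infinity"
    and g1: "((\<lambda>x. gh_weight lam \<alpha> x * g1 x) \<longlongrightarrow> 0) at_infinity"
  shows "(stein_flux lam \<alpha> \<delta> g g1 \<longlongrightarrow> 0) at_infinity"
proof -
  obtain C1 where C1: "0 < C1" "\<forall>\<^sub>F x in at_infinity. scaled_bessel_K \<alpha> (lam - 1/2) (x\<^sup>2 + \<delta>\<^sup>2)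
      \<le> C1 * (sqrt (x\<^sup>2 + \<delta>\<^sup>2) powr (lam - 1/2 - 1/2 - lam) * smooth_weight lam \<alpha> \<delta> x)"
    using scaled_bessel_K_comparable_weight(2)[OF a d] by blast
  obtain C2 where C2: "0 < C2" "\<forall>\<^sub>F x in at_infinity. scaled_bessel_K \<alpha> (lam + 1/2) (x\<^sup>2 + \<delta>\<^sup>2)
      \<le> C2 * (sqrt (x\<^sup>2 + \<delta>\<^sup>2) powr (lam + 1/2 - 1/2 - lam) * smooth_weight lam \<alpha> \<delta> x)"
    using scaled_bessel_K_comparable_weight(2)[OF a d] by blast
  have t1: "((\<lambda>x. scaled_bessel_K \<alpha> (lam - 1/2) (x\<^sup>2 + \<delta>\<^sup>2) * ((x\<^sup>2 + \<delta>\<^sup>2) / x) * g1 x) \<longlongrightarrow> 0) at_infinity"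
  proof (rule tendsto_0_le[OF g1, where K="4 * C1"])
    show "\<forall>\<^sub>F x in at_infinity. norm (scaled_bessel_K \<alpha> (lam - 1/2) (x\<^sup>2 + \<delta>\<^sup>2) * ((x\<^sup>2 + \<delta>\<^sup>2) / x) * g1 x) \<le> norm (gh_weight lam \<alpha> x * g1 x) * (4 * C1)"
      using C1(2) gh_weight_comparable[OF a d, of lam] eventually_abs_ge_at_infinity[of \<delta>]
    proof eventually_elim
      case (elim x)
      define s where "s = sqrt (x\<^sup>2 + \<delta>\<^sup>2)"
      have y: "0 < x\<^sup>2 + \<delta>\<^sup>2" using d by (simp add: add_nonneg_pos)
      have s: "0 < s" "x\<^sup>2 + \<delta>\<^sup>2 = s * s" using y by (auto simp: s_def)
      have x: "0 < \<bar>x\<bar>" "s \<le> 2 * \<bar>x\<bar>" using sqrt_sum_squares_bounds[of \<delta> x] elim d by (auto simp: s_def)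
      have "scaled_bessel_K \<alpha> (lam - 1/2) (x\<^sup>2 + \<delta>\<^sup>2) \<le> C1 * (smooth_weight lam \<alpha> \<delta> x / s)"
        using elim(1) s(1) unfolding s_def[symmetric] by (simp add: powr_minus field_simps)
      also have "\<dots> \<le> C1 * (2 * gh_weight lam \<alpha> x / s)"
        using elim(2) s C1(1) by (intro mult_left_mono divide_right_mono) auto
      finally have "scaled_bessel_K \<alpha> (lam - 1/2) (x\<^sup>2 + \<delta>\<^sup>2) * ((x\<^sup>2 + \<delta>\<^sup>2) / \<bar>x\<bar>) \<le> C1 * (2 * gh_weight lam \<alpha> x / s) * (s * s / \<bar>x\<bar>)"
        unfolding s(2) by (intro mult_right_mono) auto
      also have "\<dots> = C1 * 2 * gh_weight lam \<alpha> x * (s / \<bar>x\<bar>)" using s x by simp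
      also have "\<dots> \<le> C1 * 2 * gh_weight lam \<alpha> x * 2"
        using x C1(1) by (intro mult_left_mono) (auto simp: divide_le_eq gh_weight_def)
      finally have *: "scaled_bessel_K \<alpha> (lam - 1/2) (x\<^sup>2 + \<delta>\<^sup>2) * ((x\<^sup>2 + \<delta>\<^sup>2) / \<bar>x\<bar>) \<le> 4 * C1 * gh_weight lam \<alpha> x" by simp
      have "norm (scaled_bessel_K \<alpha> (lam - 1/2) (x\<^sup>2 + \<delta>\<^sup>2) * ((x\<^sup>2 + \<delta>\<^sup>2) / x) * g1 x)
          = scaled_bessel_K \<alpha> (lam - 1/2) (x\<^sup>2 + \<delta>\<^sup>2) * ((x\<^sup>2 + \<delta>\<^sup>2) / \<bar>x\<bar>) * \<bar>g1 x\<bar>"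
        unfolding real_norm_def abs_mult abs_divide
        using abs_of_pos[OF scaled_bessel_K_pos[OF a y, of "lam - 1/2"]] abs_of_pos[OF y] by (simp only:)
      also have "\<dots> \<le> 4 * C1 * gh_weight lam \<alpha> x * \<bar>g1 x\<bar>" using * by (rule mult_right_mono) simp
      finally show ?case by (simp add: abs_mult gh_weight_def mult_ac)
    qed
  qed
  have t2: "((\<lambda>x. scaled_bessel_K \<alpha> (lam + 1/2) (x\<^sup>2 + \<delta>\<^sup>2) * g x) \<longlongrightarrow> 0) at_infinity"
  proof (rule tendsto_0_le[OF g, where K="2 * C2"])
    show "\<forall>\<^sub>F x in at_infinity. norm (scaled_bessel_K \<alpha> (lam + 1/2) (x\<^sup>2 + \<delta>\<^sup>2) * g x) \<le> norm (gh_weight lam \<alpha> x * g x) * (2 * C2)"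
      using C2(2) gh_weight_comparable[OF a d, of lam]
    proof eventually_elim
      case (elim x)
      have y: "0 < x\<^sup>2 + \<delta>\<^sup>2" using d by (simp add: add_nonneg_pos)
      have "scaled_bessel_K \<alpha> (lam + 1/2) (x\<^sup>2 + \<delta>\<^sup>2) \<le> C2 * smooth_weight lam \<alpha> \<delta> x" using elim(1) d by simp
      also have "\<dots> \<le> C2 * (2 * gh_weight lam \<alpha> x)" using elim(2) C2(1) by (intro mult_left_mono) auto
      finally have "scaled_bessel_K \<alpha> (lam + 1/2) (x\<^sup>2 + \<delta>\<^sup>2) * \<bar>g x\<bar> \<le> C2 * (2 * gh_weight lam \<alpha> x) * \<bar>g x\<bar>"
        by (rule mult_right_mono) simp
      then show ?case using abs_of_pos[OF scaled_bessel_K_pos[OF a y, of "lam + 1/2"]] by (simp add: abs_mult gh_weight_def mult_ac)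
    qed
  qed
  have "((\<lambda>x. scaled_bessel_K \<alpha> (lam - 1/2) (x\<^sup>2 + \<delta>\<^sup>2) * ((x\<^sup>2 + \<delta>\<^sup>2) / x) * g1 x + \<alpha> * (scaled_bessel_K \<alpha> (lam + 1/2) (x\<^sup>2 + \<delta>\<^sup>2) * g x)) \<longlongrightarrow> 0 + \<alpha> * 0) at_infinity"
    by (intro tendsto_intros t1 t2)
  then show ?thesis unfolding stein_flux_def[abs_def] by (simp add: mult.assoc)
qed

text \<open>
  A finite limit of the flux gives \<open>g1 x / x\<close> a finite limit, so \<open>g1\<close> vanishes at 0 and the limit
  of the quotient is the derivative m.  The value of L does not depend on the side from which the filter A approaches 0.
\<close>

lemma stein_flux_limit_at_pole:
  assumes a: "0 < \<alpha>" and d: "0 < \<delta>" and A: "A \<le> at (0::real)" "A \<noteq> bot"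
    and g: "isCont g 0" and g1: "(g1 has_real_derivative m) (at 0)"
    and L: "(stein_flux lam \<alpha> \<delta> g g1 \<longlongrightarrow> L) A"
  shows "L = scaled_bessel_K \<alpha> (lam - 1/2) (\<delta>\<^sup>2) * \<delta>\<^sup>2 * m + \<alpha> * scaled_bessel_K \<alpha> (lam + 1/2) (\<delta>\<^sup>2) * g 0"
proof -
  have A0: "(f \<longlongrightarrow> f 0) A" if "isCont f 0" for f :: "real \<Rightarrow> real"
    using that A(1) by (auto simp: isCont_def intro: tendsto_mono)
  have nz: "\<forall>\<^sub>F x in A. x \<noteq> 0"
    using A(1) by (rule filter_leD) (simp add: eventually_at_filter)
  have H: "((\<lambda>x. scaled_bessel_K \<alpha> \<nu> (x\<^sup>2 + \<delta>\<^sup>2)) \<longlongrightarrow> scaled_bessel_K \<alpha> \<nu> (\<delta>\<^sup>2)) A" for \<nu>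
    using A0[OF DERIV_isCont[OF has_derivative_scaled_bessel_K_radial[OF a d]]] by simp
  have y: "((\<lambda>x. x\<^sup>2 + \<delta>\<^sup>2) \<longlongrightarrow> \<delta>\<^sup>2) A"
    using A0[of "\<lambda>x. x\<^sup>2 + \<delta>\<^sup>2"] by simp
  have id: "((\<lambda>x. x) \<longlongrightarrow> 0) A" using A0[of "\<lambda>x. x"] by simp
  have Hy0: "scaled_bessel_K \<alpha> (lam - 1/2) (\<delta>\<^sup>2) * \<delta>\<^sup>2 \<noteq> 0" using scaled_bessel_K_pos[OF a, of "\<delta>\<^sup>2" "lam - 1/2"] d by simp
  define M where "M = (L - \<alpha> * scaled_bessel_K \<alpha> (lam + 1/2) (\<delta>\<^sup>2) * g 0) / (scaled_bessel_K \<alpha> (lam - 1/2) (\<delta>\<^sup>2) * \<delta>\<^sup>2)"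
  have "((\<lambda>x. (stein_flux lam \<alpha> \<delta> g g1 x - \<alpha> * scaled_bessel_K \<alpha> (lam + 1/2) (x\<^sup>2 + \<delta>\<^sup>2) * g x) /
      (scaled_bessel_K \<alpha> (lam - 1/2) (x\<^sup>2 + \<delta>\<^sup>2) * (x\<^sup>2 + \<delta>\<^sup>2))) \<longlongrightarrow> M) A"
    unfolding M_def by (intro tendsto_intros L H y A0[OF g] Hy0)
  moreover have "\<forall>\<^sub>F x in A. (stein_flux lam \<alpha> \<delta> g g1 x - \<alpha> * scaled_bessel_K \<alpha> (lam + 1/2) (x\<^sup>2 + \<delta>\<^sup>2) * g x) /
      (scaled_bessel_K \<alpha> (lam - 1/2) (x\<^sup>2 + \<delta>\<^sup>2) * (x\<^sup>2 + \<delta>\<^sup>2)) = g1 x / x"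
    using nz
  proof eventually_elim
    case (elim x)
    have y: "0 < x\<^sup>2 + \<delta>\<^sup>2" using d by (simp add: add_nonneg_pos)
    have "(q * (y / x) * p + r - r) / (q * y) = p / x" if "0 < q" "0 < y" for p q r y :: real
      using that by simp
    from this[OF scaled_bessel_K_pos[OF a y] y] show ?case unfolding stein_flux_def .
  qed
  ultimately have q: "((\<lambda>x. g1 x / x) \<longlongrightarrow> M) A" by (rule Lim_transform_eventually)
  have "((\<lambda>x. g1 x / x * x) \<longlongrightarrow> M * 0) A" by (intro tendsto_intros q id)
  moreover have "\<forall>\<^sub>F x in A. g1 x / x * x = g1 x"
    using nz by eventually_elim simp
  ultimately have "(g1 \<longlongrightarrow> 0) A"
    using Lim_transform_eventually by fastforce
  moreover have "(g1 \<longlongrightarrow> g1 0) A" by (rule A0[OF DERIV_isCont[OF g1]])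
  ultimately have "g1 0 = 0" using A(2) tendsto_unique by blast
  with g1 have "((\<lambda>x. g1 x / x) \<longlongrightarrow> m) (at 0)" by (simp add: DERIV_def)
  then have "((\<lambda>x. g1 x / x) \<longlongrightarrow> m) A" by (rule tendsto_mono[OF A(1)])
  with q have "M = m" using A(2) tendsto_unique by blast
  then show ?thesis using Hy0 unfolding M_def by (simp add: field_simps)
qed

section \<open>The Stein identity under the generalised hyperbolic law\<close>

lemma piecewise_C2_derivatives:
  assumes "piecewise_C2 f"
  shows "(f has_real_derivative deriv f x) (at x)" "continuous_on UNIV (deriv f)"
    "\<exists>S f2. finite S \<and> (\<forall>x. x \<notin> S \<longrightarrow> (deriv f has_real_derivative f2 x) (at x))"
proof -
  show "(f has_real_derivative deriv f x) (at x)"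
    using assms DERIV_deriv_iff_real_differentiable unfolding piecewise_C2_def by blast
  obtain S where S: "continuous_on UNIV (deriv f)" "finite S" "deriv f C1_differentiable_on (UNIV - S)"
    using assms unfolding piecewise_C2_def piecewise_C1_differentiable_on_def by blast
  show "continuous_on UNIV (deriv f)" by (rule S)
  obtain D where "\<And>x. x \<notin> S \<Longrightarrow> (deriv f has_vector_derivative D x) (at x)"
    using S(3) unfolding C1_differentiable_on_def by auto
  then show "\<exists>S f2. finite S \<and> (\<forall>x. x \<notin> S \<longrightarrow> (deriv f has_real_derivative f2 x) (at x))"
    using S(2) by (auto simp: has_real_derivative_iff_has_vector_derivative)
qed

lemma gh_density_measurable:
  assumes d: "0 < \<delta>" and b: "\<bar>\<beta>\<bar> < \<alpha>"
  shows "gh_density lam \<alpha> \<beta> \<delta> \<in> borel_measurable borel"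
proof -
  have "continuous_on UNIV (\<lambda>x. gh_density lam \<alpha> \<beta> \<delta> x)"
    unfolding gh_density_eq_scaled_bessel_K[OF d b]
    by (intro continuous_intros continuous_on_scaled_bessel_K_radial) (use d b in auto)
  then show ?thesis by (rule borel_measurable_continuous_onI)
qed

lemma gh_density_pos:
  assumes d: "0 < \<delta>" and b: "\<bar>\<beta>\<bar> < \<alpha>"
  shows "0 < gh_density lam \<alpha> \<beta> \<delta> x"
  unfolding gh_density_eq_scaled_bessel_K[OF d b]
  using gh_const_pos[OF d b] scaled_bessel_K_radial_pos[of \<alpha> \<delta>] d b by simp

text \<open>
  The flux has the integrand as its derivative off finitely many points, vanishes at both infinities,
  and has equal limits from both sides at 0, so its increments over the two half lines cancel.
\<close>

lemma stein_identity_gh: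
  assumes d: "0 < \<delta>" and b: "\<bar>\<beta>\<bar> < \<alpha>" and f: "gh_test_function lam \<alpha> \<beta> \<delta> f"
  shows "(LINT x|gh_measure lam \<alpha> \<beta> \<delta>. gh_stein_op lam \<alpha> \<beta> \<delta> f x) = 0"
proof -
  have a: "0 < \<alpha>" using b by simp
  have pc: "piecewise_C2 f" and f'0: "deriv f differentiable (at 0)"
    and int: "integrable (gh_measure lam \<alpha> \<beta> \<delta>) (gh_stein_op lam \<alpha> \<beta> \<delta> f)"
    and decay: "\<And>k. k \<in> {0, 1, 2} \<Longrightarrow> ((\<lambda>x. \<bar>x\<bar> powr lam * exp (- \<alpha> * \<bar>x\<bar> + \<beta> * x) * (deriv ^^ k) f x) \<longlongrightarrow> 0) at_infinity"
    using f unfolding gh_test_function_def by auto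
  define f1 where "f1 = deriv f"
  have f: "\<And>x. (f has_real_derivative f1 x) (at x)" and f1c: "continuous_on UNIV f1" and df: "deriv f = f1"
    using piecewise_C2_derivatives(1,2)[OF pc] by (auto simp: f1_def)
  obtain S f2 where S: "finite S" and f1: "\<And>x. x \<notin> S \<Longrightarrow> (f1 has_real_derivative f2 x) (at x)"
    using piecewise_C2_derivatives(3)[OF pc] unfolding f1_def by blast
  obtain m0 where m0: "(f1 has_real_derivative m0) (at 0)"
    using f'0 df real_differentiable_def by auto
  define g where "g x = exp (\<beta> * x) * f x" for x
  define g1 where "g1 x = exp (\<beta> * x) * (f1 x + \<beta> * f x)" for x
  define g2 where "g2 x = exp (\<beta> * x) * (f2 x + 2 * \<beta> * f1 x + \<beta>\<^sup>2 * f x)" for x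
  have g: "(g has_real_derivative g1 x) (at x)" for x
    unfolding g_def g1_def by (auto intro!: derivative_eq_intros f simp: algebra_simps)
  have g1': "(g1 has_real_derivative exp (\<beta> * x) * (m + 2 * \<beta> * f1 x + \<beta>\<^sup>2 * f x)) (at x)"
    if "(f1 has_real_derivative m) (at x)" for m x
    unfolding g1_def by (auto intro!: derivative_eq_intros f that simp: algebra_simps power2_eq_square)
  have g1: "(g1 has_real_derivative g2 x) (at x)" if "x \<notin> S" for x
    unfolding g2_def by (rule g1'[OF f1[OF that]])
  obtain m where m: "(g1 has_real_derivative m) (at 0)" using g1'[OF m0] by blast
  have gc: "continuous_on UNIV g" using DERIV_isCont[OF g] by (auto intro: continuous_at_imp_continuous_on)
  have fc: "continuous_on UNIV f" using DERIV_isCont[OF f] by (auto intro: continuous_at_imp_continuous_on)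
  have g1c: "continuous_on UNIV g1" unfolding g1_def[abs_def] by (intro continuous_intros f1c fc)
  have Hc: "continuous_on A (\<lambda>x. scaled_bessel_K \<alpha> \<nu> (x\<^sup>2 + \<delta>\<^sup>2))" for A \<nu>
    by (rule continuous_on_scaled_bessel_K_radial[OF a d])
  define F where "F = stein_flux lam \<alpha> \<delta> g g1"
  have Fc: "continuous_on A F" if "0 \<notin> A" for A
    unfolding F_def stein_flux_def[abs_def]
    by (intro continuous_intros Hc continuous_on_subset[OF gc] continuous_on_subset[OF g1c]) (use that in auto)
  define \<phi> where "\<phi> x = scaled_bessel_K \<alpha> (lam - 1/2) (x\<^sup>2 + \<delta>\<^sup>2) * (exp (\<beta> * x) * gh_stein_op lam \<alpha> \<beta> \<delta> f x)" for x
  have FD: "(F has_real_derivative \<phi> x) (at x)" if "x \<noteq> 0" "x \<notin> S" for x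
    using has_derivative_stein_flux[OF a d that(1) g g1[OF that(2)], of lam]
    unfolding \<phi>_def F_def gh_stein_op_conjugate[OF that(1) f f1[OF that(2)]] g2_def g1_def g_def .
  have F0: "(F \<longlongrightarrow> 0) at_infinity"
    unfolding F_def
  proof (rule stein_flux_vanishes_at_infinity[OF a d])
    have e: "\<bar>x\<bar> powr lam * exp (- \<alpha> * \<bar>x\<bar> + \<beta> * x) = gh_weight lam \<alpha> x * exp (\<beta> * x)" for x
      unfolding gh_weight_def mult.assoc exp_add[symmetric] by simp
    have 0: "((\<lambda>x. gh_weight lam \<alpha> x * exp (\<beta> * x) * f x) \<longlongrightarrow> 0) at_infinity"
      using decay[of 0] unfolding e by simp
    have 1: "((\<lambda>x. gh_weight lam \<alpha> x * exp (\<beta> * x) * f1 x) \<longlongrightarrow> 0) at_infinity"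
      using decay[of 1] unfolding e by (simp add: df)
    show "((\<lambda>x. gh_weight lam \<alpha> x * g x) \<longlongrightarrow> 0) at_infinity"
      using 0 by (simp add: g_def mult.assoc)
    have "((\<lambda>x. gh_weight lam \<alpha> x * exp (\<beta> * x) * f1 x + \<beta> * (gh_weight lam \<alpha> x * exp (\<beta> * x) * f x)) \<longlongrightarrow> 0 + \<beta> * 0) at_infinity"
      by (intro tendsto_intros 0 1)
    then show "((\<lambda>x. gh_weight lam \<alpha> x * g1 x) \<longlongrightarrow> 0) at_infinity"
      by (simp add: g1_def algebra_simps)
  qed
  have Ftop: "(F \<longlongrightarrow> 0) at_top" and Fbot: "(F \<longlongrightarrow> 0) at_bot"
    using F0 unfolding at_infinity_eq_at_top_bot by (auto elim: filterlim_mono)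
  have opm: "gh_stein_op lam \<alpha> \<beta> \<delta> f \<in> borel_measurable borel"
    using borel_measurable_integrable[OF int] by (simp add: gh_measure_def)
  have ip: "integrable lborel (\<lambda>x. gh_density lam \<alpha> \<beta> \<delta> x * gh_stein_op lam \<alpha> \<beta> \<delta> f x)"
    using int opm gh_density_measurable[OF d b] gh_density_pos[OF d b] unfolding gh_measure_def
    by (subst (asm) integrable_density) (auto simp: less_imp_le)
  define c where "c = gh_const lam \<alpha> \<beta> \<delta>"
  have c: "0 < c" using gh_const_pos[OF d b] by (simp add: c_def)
  have pe: "gh_density lam \<alpha> \<beta> \<delta> x * gh_stein_op lam \<alpha> \<beta> \<delta> f x = c * \<phi> x" for x
    unfolding gh_density_eq_scaled_bessel_K[OF d b] c_def \<phi>_def by (simp add: mult_ac)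
  have i\<phi>: "integrable lborel \<phi>" using ip c unfolding pe by simp
  have si: "set_integrable lborel A \<phi>" if "A \<in> sets borel" for A
    using integrable_mult_indicator[OF _ i\<phi>, of A] that by (simp add: set_integrable_def)
  have R: "(F \<longlongrightarrow> 0 - (LINT x:{0<..}|lborel. \<phi> x)) (at_right 0)"
    using Ftop Fbot
    by (intro improper_increment_right[OF S Fc FD si]) auto
  have L: "(F \<longlongrightarrow> 0 + (LINT x:{..<0}|lborel. \<phi> x)) (at_left 0)"
    using Ftop Fbot
    by (intro improper_increment_left[OF S Fc FD si]) auto
  have g0: "isCont g 0" by (rule DERIV_isCont[OF g])
  have "- (LINT x:{0<..}|lborel. \<phi> x) = (LINT x:{..<0}|lborel. \<phi> x)"
    using stein_flux_limit_at_pole[OF a d _ _ g0 m R[unfolded F_def]]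
      stein_flux_limit_at_pole[OF a d _ _ g0 m L[unfolded F_def]]
    by (simp add: at_le)
  then have "(LINT x:{..<0} \<union> {0<..}|lborel. \<phi> x) = 0"
    by (subst set_integral_Un) (auto intro: si)
  also have "(LINT x:{..<0} \<union> {0<..}|lborel. \<phi> x) = (LINT x|lborel. \<phi> x)"
    unfolding set_lebesgue_integral_def
  proof (rule integral_cong_AE)
    show "AE x in lborel. indicator ({..<0} \<union> {0<..}) x *\<^sub>R \<phi> x = \<phi> x"
      by (rule AE_I[where N="{0}"]) (auto simp: indicator_def)
  qed (use i\<phi> si[of "{..<0} \<union> {0<..}"] in \<open>auto simp: set_integrable_def\<close>)
  finally have "(LINT x|lborel. \<phi> x) = 0" .
  then have "(LINT x|lborel. gh_density lam \<alpha> \<beta> \<delta> x * gh_stein_op lam \<alpha> \<beta> \<delta> f x) = 0"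
    unfolding pe by simp
  then show ?thesis
    unfolding gh_measure_def using opm gh_density_measurable[OF d b] gh_density_pos[OF d b]
    by (subst integral_density) (auto simp: less_imp_le)
qed

section \<open>Solving the Stein equation\<close>

text \<open>
  Variation of constants for the first-order equation that prescribes the flux: the factor in front
  of P solves the homogeneous equation.
\<close>

definition stein_solution :: "real \<Rightarrow> real \<Rightarrow> real \<Rightarrow> (real \<Rightarrow> real) \<Rightarrow> real \<Rightarrow> real" where
  "stein_solution lam \<alpha> \<delta> P x = (x\<^sup>2 + \<delta>\<^sup>2) powr (1/2 - lam) * scaled_bessel_K \<alpha> (lam - 1/2) (x\<^sup>2 + \<delta>\<^sup>2) * P x"

text \<open>
  The quotient \<open>g' / x\<close> for the solution g whose flux is F, obtained by solving the definition of
  the flux for \<open>g'\<close>.  It has no singularity at 0, which is why the solution passes through the pole.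
\<close>

definition stein_slope :: "real \<Rightarrow> real \<Rightarrow> real \<Rightarrow> (real \<Rightarrow> real) \<Rightarrow> (real \<Rightarrow> real) \<Rightarrow> real \<Rightarrow> real" where
  "stein_slope lam \<alpha> \<delta> F P x =
     (F x - \<alpha> * scaled_bessel_K \<alpha> (lam + 1/2) (x\<^sup>2 + \<delta>\<^sup>2) * stein_solution lam \<alpha> \<delta> P x)
       / (scaled_bessel_K \<alpha> (lam - 1/2) (x\<^sup>2 + \<delta>\<^sup>2) * (x\<^sup>2 + \<delta>\<^sup>2))"

text \<open>
  The derivative that P must have for \<open>stein_solution\<close> to have flux F.
\<close>

definition stein_integrand :: "real \<Rightarrow> real \<Rightarrow> real \<Rightarrow> (real \<Rightarrow> real) \<Rightarrow> real \<Rightarrow> real" where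
  "stein_integrand lam \<alpha> \<delta> F x =
     x * F x / ((x\<^sup>2 + \<delta>\<^sup>2) powr (3/2 - lam) * (scaled_bessel_K \<alpha> (lam - 1/2) (x\<^sup>2 + \<delta>\<^sup>2))\<^sup>2)"

lemma has_derivative_stein_solution:
  assumes a: "0 < \<alpha>" and d: "0 < \<delta>"
    and P: "(P has_real_derivative stein_integrand lam \<alpha> \<delta> F x) (at x)"
  shows "(stein_solution lam \<alpha> \<delta> P has_real_derivative x * stein_slope lam \<alpha> \<delta> F P x) (at x)"
proof -
  define y where "y = x\<^sup>2 + \<delta>\<^sup>2"
  have y: "0 < y" using d by (simp add: y_def add_nonneg_pos)
  define H where "H \<nu> = scaled_bessel_K \<alpha> \<nu> y" for \<nu>
  have H: "0 < H \<nu>" for \<nu> unfolding H_def by (rule scaled_bessel_K_pos[OF a y])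
  have rec: "\<alpha> * H (lam + 1/2) = (2 * lam - 1) * H (lam - 1/2) + \<alpha> * y * H (lam - 1/2 - 1)"
  proof -
    have e: "lam - 1/2 + 1 = lam + 1/2" "2 * (lam - 1/2) = 2 * lam - 1" by auto
    show ?thesis using scaled_bessel_K_recurrence[OF a y, of "lam - 1/2"] unfolding e H_def ..
  qed
  have dy: "((\<lambda>x. x\<^sup>2 + \<delta>\<^sup>2) has_real_derivative 2 * x) (at x)"
    by (auto intro!: derivative_eq_intros)
  have dp: "((\<lambda>x. (x\<^sup>2 + \<delta>\<^sup>2) powr (1/2 - lam)) has_real_derivative (1/2 - lam) * y powr (1/2 - lam - 1) * (2 * x)) (at x)"
    using DERIV_fun_powr[OF dy, of "1/2 - lam"] y unfolding y_def by simp
  have dH: "((\<lambda>x. scaled_bessel_K \<alpha> (lam - 1/2) (x\<^sup>2 + \<delta>\<^sup>2)) has_real_derivative - \<alpha> * x * H (lam - 1/2 - 1)) (at x)"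
    using has_derivative_scaled_bessel_K_radial[OF a d] unfolding H_def y_def .
  define u where "u = y powr (1/2 - lam)"
  have u: "0 < u" "y powr (1/2 - lam - 1) = u / y" "y powr (3/2 - lam) = u * y"
    using y by (auto simp: u_def powr_diff powr_add[symmetric] powr_mult_base field_simps)
  have sol: "stein_solution lam \<alpha> \<delta> P x = u * H (lam - 1/2) * P x"
    unfolding stein_solution_def u_def H_def y_def ..
  have slope: "stein_slope lam \<alpha> \<delta> F P x = (F x - \<alpha> * H (lam + 1/2) * (u * H (lam - 1/2) * P x)) / (H (lam - 1/2) * y)"
    unfolding stein_slope_def sol by (simp add: H_def y_def)
  have integrand: "stein_integrand lam \<alpha> \<delta> F x = x * F x / (u * y * (H (lam - 1/2))\<^sup>2)"
    unfolding stein_integrand_def y_def[symmetric] u(3) H_def ..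
  have "((\<lambda>x. (x\<^sup>2 + \<delta>\<^sup>2) powr (1/2 - lam) * scaled_bessel_K \<alpha> (lam - 1/2) (x\<^sup>2 + \<delta>\<^sup>2) * P x) has_real_derivative
     x * stein_slope lam \<alpha> \<delta> F P x) (at x)"
  proof (rule DERIV_cong[OF DERIV_mult[OF DERIV_mult[OF dp dH] P]])
    show "((1/2 - lam) * y powr (1/2 - lam - 1) * (2 * x) * scaled_bessel_K \<alpha> (lam - 1/2) (x\<^sup>2 + \<delta>\<^sup>2)
        + - \<alpha> * x * H (lam - 1/2 - 1) * (x\<^sup>2 + \<delta>\<^sup>2) powr (1/2 - lam)) * P x
      + stein_integrand lam \<alpha> \<delta> F x * ((x\<^sup>2 + \<delta>\<^sup>2) powr (1/2 - lam) * scaled_bessel_K \<alpha> (lam - 1/2) (x\<^sup>2 + \<delta>\<^sup>2))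
      = x * stein_slope lam \<alpha> \<delta> F P x"
      unfolding integrand slope rec y_def[symmetric] u(2) u_def[symmetric] H_def[symmetric]
      using y u(1) H[of "lam - 1/2"] by (simp add: field_simps power2_eq_square)
  qed
  then show ?thesis unfolding stein_solution_def[abs_def] .
qed

lemma stein_flux_solution:
  assumes a: "0 < \<alpha>" and d: "0 < \<delta>" and x: "x \<noteq> 0"
  shows "stein_flux lam \<alpha> \<delta> (stein_solution lam \<alpha> \<delta> P) (\<lambda>x. x * stein_slope lam \<alpha> \<delta> F P x) x = F x"
proof -
  have y: "0 < x\<^sup>2 + \<delta>\<^sup>2" using d by (simp add: add_nonneg_pos)
  have "q * (y / x) * (x * ((p - r) / (q * y))) + r = p" if "0 < q" "0 < y" for p q r y :: real
    using x that by simp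
  from this[OF scaled_bessel_K_pos[OF a y] y] show ?thesis unfolding stein_flux_def stein_slope_def .
qed

text \<open>
  The derivative of P is bounded by a multiple of \<open>\<bar>F\<bar>\<close> times the derivative of
  \<open>E = exp (2 \<alpha> s)\<close>, so P = o(E) by L'Hopital's rule.  The factor in front of P, multiplied by the
  weight, is of order at most \<open>1 / E\<close>.
\<close>

lemma stein_solution_decay_at_top:
  assumes a: "0 < \<alpha>" and d: "0 < \<delta>"
    and P: "\<And>x. (P has_real_derivative stein_integrand lam \<alpha> \<delta> F x) (at x)"
    and F: "(F \<longlongrightarrow> 0) at_top"
  shows "((\<lambda>x. gh_weight lam \<alpha> x * stein_solution lam \<alpha> \<delta> P x) \<longlongrightarrow> 0) at_top"
    and "((\<lambda>x. gh_weight lam \<alpha> x * (x * stein_slope lam \<alpha> \<delta> F P x)) \<longlongrightarrow> 0) at_top"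
proof -
  define s where "s x = sqrt (x\<^sup>2 + \<delta>\<^sup>2)" for x
  define \<omega> where "\<omega> x = smooth_weight lam \<alpha> \<delta> x" for x
  define H where "H x = scaled_bessel_K \<alpha> (lam - 1/2) (x\<^sup>2 + \<delta>\<^sup>2)" for x
  define Hp where "Hp x = scaled_bessel_K \<alpha> (lam + 1/2) (x\<^sup>2 + \<delta>\<^sup>2)" for x
  define w where "w = gh_weight lam \<alpha>"
  have y: "0 < x\<^sup>2 + \<delta>\<^sup>2" for x using d by (simp add: add_nonneg_pos)
  have s: "0 < s x" "x\<^sup>2 + \<delta>\<^sup>2 = s x * s x" for x using y[of x] by (auto simp: s_def)
  have xs: "\<bar>x\<bar> \<le> s x" for x unfolding s_def by (intro real_le_rsqrt) auto
  have yp: "(x\<^sup>2 + \<delta>\<^sup>2) powr p = s x powr (2 * p)" for x p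
    unfolding s(2) using s(1)[of x] by (simp add: powr_mult powr_add[symmetric])
  have w0: "0 < \<omega> x" for x unfolding \<omega>_def by (rule smooth_weight_pos[OF d])
  have wdef: "\<omega> x = s x powr lam * exp (- \<alpha> * s x)" for x unfolding \<omega>_def smooth_weight_def s_def ..
  have H0: "0 < H x" and Hp0: "0 < Hp x" for x unfolding H_def Hp_def using scaled_bessel_K_pos[OF a y] by auto
  have ww: "0 \<le> w x" for x unfolding w_def gh_weight_def by simp
  obtain c where c: "0 < c"
    and lo': "\<forall>\<^sub>F x in at_infinity. c * (s x powr (lam - 1/2 - 1/2 - lam) * \<omega> x) \<le> H x"
    using scaled_bessel_K_comparable_weight(1)[OF a d, of "lam - 1/2" lam] unfolding s_def \<omega>_def H_def by blast
  obtain C where C: "0 < C"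
    and up1: "\<forall>\<^sub>F x in at_infinity. H x \<le> C * (s x powr (lam - 1/2 - 1/2 - lam) * \<omega> x)"
    using scaled_bessel_K_comparable_weight(2)[OF a d, of "lam - 1/2" lam] unfolding s_def \<omega>_def H_def by blast
  obtain C' where C': "0 < C'"
    and up2: "\<forall>\<^sub>F x in at_infinity. Hp x \<le> C' * (s x powr (lam + 1/2 - 1/2 - lam) * \<omega> x)"
    using scaled_bessel_K_comparable_weight(2)[OF a d, of "lam + 1/2" lam] unfolding s_def \<omega>_def Hp_def by blast
  have e1: "s x powr (lam - 1/2 - 1/2 - lam) * \<omega> x = \<omega> x / s x" for x
    using s(1)[of x] by (simp add: powr_minus field_simps)
  have e2: "s x powr (lam + 1/2 - 1/2 - lam) * \<omega> x = \<omega> x" for x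
    using s(1)[of x] by simp
  note lo = lo'[unfolded e1] and up = up1[unfolded e1] and up' = up2[unfolded e2]
  have cmp: "\<forall>\<^sub>F x in at_infinity. w x \<le> 2 * \<omega> x"
    using gh_weight_comparable[OF a d, of lam] unfolding w_def \<omega>_def by (auto elim: eventually_mono)
  have top: "\<forall>\<^sub>F x in at_top. Q x" if "\<forall>\<^sub>F x in at_infinity. Q x" for Q :: "real \<Rightarrow> bool"
    using that by (rule filter_leD[rotated]) (simp add: at_infinity_eq_at_top_bot)

  define E where "E x = exp (2 * \<alpha> * s x)" for x
  have E0: "0 < E x" for x by (simp add: E_def)
  \<comment> \<open>The Bessel function enters the derivative of P squared; its exponential decay cancels E exactly, up to a power of s.\<close>
  have \<omega>2: "\<omega> x * \<omega> x * E x = s x powr (2 * lam)" for x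
    unfolding wdef E_def by (simp add: powr_add[symmetric] exp_add[symmetric] mult.assoc mult.left_commute)
  have ds: "(s has_real_derivative x / s x) (at x)" for x
    unfolding s_def using y[of x] by (auto intro!: derivative_eq_intros simp: field_simps)
  have dE: "(E has_real_derivative 2 * \<alpha> * (x / s x) * E x) (at x)" for x
    unfolding E_def by (auto intro!: derivative_eq_intros ds)
  have PE: "((\<lambda>x. P x / E x) \<longlongrightarrow> 0) at_top"
  proof (rule lhospital_at_top_at_top)
    show "LIM x at_top. E x :> at_top"
    proof (rule filterlim_at_top_mono)
      show "LIM x at_top. exp (2 * \<alpha> * x) :> at_top" using a by real_asymp
      show "\<forall>\<^sub>F x in at_top. exp (2 * \<alpha> * x) \<le> E x"
        using a xs by (intro always_eventually allI) (auto simp: E_def intro: order_trans[OF abs_ge_self])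
    qed
    show "\<forall>\<^sub>F x in at_top. 2 * \<alpha> * (x / s x) * E x \<noteq> 0"
      using eventually_gt_at_top[of 0] by eventually_elim (use a s E0 in \<open>auto simp: less_imp_neq[THEN not_sym]\<close>)
    show "\<forall>\<^sub>F x in at_top. (P has_real_derivative stein_integrand lam \<alpha> \<delta> F x) (at x)" using P by simp
    show "\<forall>\<^sub>F x in at_top. (E has_real_derivative 2 * \<alpha> * (x / s x) * E x) (at x)" using dE by simp
    show "((\<lambda>x. stein_integrand lam \<alpha> \<delta> F x / (2 * \<alpha> * (x / s x) * E x)) \<longlongrightarrow> 0) at_top"
    proof (rule tendsto_0_le[OF F, where K="1 / (2 * \<alpha> * c\<^sup>2)"])
      show "\<forall>\<^sub>F x in at_top. norm (stein_integrand lam \<alpha> \<delta> F x / (2 * \<alpha> * (x / s x) * E x)) \<le> norm (F x) * (1 / (2 * \<alpha> * c\<^sup>2))"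
        using top[OF lo] eventually_gt_at_top[of 0]
      proof eventually_elim
        case (elim x)
        have "c\<^sup>2 * (\<omega> x / s x)\<^sup>2 \<le> (H x)\<^sup>2"
          using elim(1) c w0[of x] s(1)[of x] unfolding power_mult_distrib[symmetric] by (intro power_mono) auto
        then have "s x powr (2 * (3/2 - lam)) * (c\<^sup>2 * (\<omega> x / s x)\<^sup>2) * E x \<le> s x powr (2 * (3/2 - lam)) * (H x)\<^sup>2 * E x"
          using E0[of x] by (intro mult_right_mono mult_left_mono) auto
        also have "s x powr (2 * (3/2 - lam)) * (c\<^sup>2 * (\<omega> x / s x)\<^sup>2) * E x
            = c\<^sup>2 * (s x powr (2 * (3/2 - lam)) * (\<omega> x * \<omega> x * E x)) / (s x * s x)"
          by (simp add: power2_eq_square)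
        also have "\<dots> = c\<^sup>2 * s x powr 3 / (s x * s x)"
          unfolding \<omega>2 by (simp add: powr_add[symmetric])
        also have "\<dots> = c\<^sup>2 * s x"
          using s(1)[of x] by (simp add: power3_eq_cube)
        finally have D: "c\<^sup>2 * s x \<le> s x powr (2 * (3/2 - lam)) * (H x)\<^sup>2 * E x" .
        define T where "T = s x powr (2 * (3/2 - lam)) * (H x)\<^sup>2 * E x"
        have T: "c\<^sup>2 * s x \<le> T" "0 < T" using D E0[of x] H0[of x] s(1)[of x] by (auto simp: T_def)
        have "stein_integrand lam \<alpha> \<delta> F x / (2 * \<alpha> * (x / s x) * E x) = F x / (2 * \<alpha>) * (s x / T)"
          unfolding stein_integrand_def H_def[symmetric] yp T_def using elim(2) s(1)[of x] by simp
        also have "norm \<dots> = norm (F x) / (2 * \<alpha>) * (s x / T)"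
          using a s(1)[of x] T(2) by (simp add: abs_mult)
        also have "\<dots> \<le> norm (F x) / (2 * \<alpha>) * (1 / c\<^sup>2)"
          using T c a by (intro mult_left_mono) (auto simp: field_simps)
        finally show ?case by simp
      qed
    qed
  qed
  show sol: "((\<lambda>x. gh_weight lam \<alpha> x * stein_solution lam \<alpha> \<delta> P x) \<longlongrightarrow> 0) at_top"
  proof (rule tendsto_0_le[OF PE, where K="2 * C"])
    show "\<forall>\<^sub>F x in at_top. norm (gh_weight lam \<alpha> x * stein_solution lam \<alpha> \<delta> P x) \<le> norm (P x / E x) * (2 * C)"
      using top[OF up] top[OF cmp]
    proof eventually_elim
      case (elim x)
      have "w x * (s x powr (2 * (1/2 - lam)) * H x) \<le> 2 * \<omega> x * (s x powr (2 * (1/2 - lam)) * (C * (\<omega> x / s x)))"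
        using elim ww H0[of x] w0[of x] by (intro mult_mono mult_left_mono) (auto simp: less_imp_le)
      also have "\<dots> = 2 * C * (s x powr (2 * (1/2 - lam)) * (\<omega> x * \<omega> x * E x)) / (s x * E x)"
        using E0[of x] by simp
      also have "\<dots> = 2 * C * s x powr 1 / (s x * E x)"
        unfolding \<omega>2 by (simp add: powr_add[symmetric])
      also have "\<dots> = 2 * C / E x" using s(1)[of x] by simp
      finally have "w x * (s x powr (2 * (1/2 - lam)) * H x) * \<bar>P x\<bar> \<le> 2 * C / E x * \<bar>P x\<bar>"
        by (rule mult_right_mono) simp
      then show ?case
        using ww[of x] H0[of x] E0[of x] unfolding w_def[symmetric] stein_solution_def yp H_def[symmetric]
        by (simp add: abs_mult mult_ac)
    qed
  qed
  have 1: "((\<lambda>x. w x * (x * F x / (H x * (x\<^sup>2 + \<delta>\<^sup>2)))) \<longlongrightarrow> 0) at_top"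
  proof (rule tendsto_0_le[OF F, where K="2 / c"])
    show "\<forall>\<^sub>F x in at_top. norm (w x * (x * F x / (H x * (x\<^sup>2 + \<delta>\<^sup>2)))) \<le> norm (F x) * (2 / c)"
      using top[OF lo] top[OF cmp]
    proof eventually_elim
      case (elim x)
      have "c * \<omega> x * s x = c * (\<omega> x / s x) * (s x * s x)" using s(1)[of x] by simp
      also have "\<dots> \<le> H x * (s x * s x)" using elim s(1)[of x] by (intro mult_right_mono) auto
      finally have 1: "c * \<omega> x * s x \<le> H x * (s x * s x)" .
      have "w x * \<bar>x\<bar> \<le> 2 * \<omega> x * s x" using elim ww w0[of x] xs by (intro mult_mono) (auto simp: less_imp_le)
      also have "\<dots> \<le> 2 / c * (H x * (s x * s x))" using 1 c by (simp add: field_simps)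
      finally have "w x * \<bar>x\<bar> / (H x * (s x * s x)) \<le> 2 / c"
        using H0[of x] s(1)[of x] by (simp add: pos_divide_le_eq)
      then have "w x * \<bar>x\<bar> / (H x * (s x * s x)) * \<bar>F x\<bar> \<le> 2 / c * \<bar>F x\<bar>" by (rule mult_right_mono) simp
      then show ?case unfolding s(2) using ww[of x] H0[of x] s(1)[of x] by (simp add: abs_mult mult_ac)
    qed
  qed
  have 2: "((\<lambda>x. \<alpha> * x * Hp x / (H x * (x\<^sup>2 + \<delta>\<^sup>2)) * (w x * stein_solution lam \<alpha> \<delta> P x)) \<longlongrightarrow> 0) at_top"
  proof (rule tendsto_0_le[OF sol, where K="\<alpha> * C' / c"])
    show "\<forall>\<^sub>F x in at_top. norm (\<alpha> * x * Hp x / (H x * (x\<^sup>2 + \<delta>\<^sup>2)) * (w x * stein_solution lam \<alpha> \<delta> P x))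
       \<le> norm (gh_weight lam \<alpha> x * stein_solution lam \<alpha> \<delta> P x) * (\<alpha> * C' / c)"
      using top[OF lo] top[OF up']
    proof eventually_elim
      case (elim x)
      have "c * \<omega> x * s x = c * (\<omega> x / s x) * (s x * s x)" using s(1)[of x] by simp
      also have "\<dots> \<le> H x * (s x * s x)" using elim s(1)[of x] by (intro mult_right_mono) auto
      finally have 1: "c * \<omega> x * s x \<le> H x * (s x * s x)" .
      have "\<alpha> * \<bar>x\<bar> * Hp x \<le> \<alpha> * s x * (C' * \<omega> x)"
        using elim(2) a xs Hp0[of x] s(1)[of x] by (intro mult_mono) (auto simp: less_imp_le)
      also have "\<dots> = \<alpha> * C' / c * (c * \<omega> x * s x)" using c by simp
      also have "\<dots> \<le> \<alpha> * C' / c * (H x * (s x * s x))" using 1 a C' c by (intro mult_left_mono) auto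
      finally have "\<alpha> * \<bar>x\<bar> * Hp x / (H x * (s x * s x)) \<le> \<alpha> * C' / c"
        using H0[of x] s(1)[of x] by (simp add: pos_divide_le_eq)
      moreover have "\<bar>\<alpha> * x * Hp x / (H x * (x\<^sup>2 + \<delta>\<^sup>2))\<bar> = \<alpha> * \<bar>x\<bar> * Hp x / (H x * (s x * s x))"
        unfolding s(2) using H0[of x] Hp0[of x] s(1)[of x] a by (simp add: abs_mult)
      ultimately have "\<bar>\<alpha> * x * Hp x / (H x * (x\<^sup>2 + \<delta>\<^sup>2))\<bar> \<le> \<alpha> * C' / c" by simp
      then show ?case unfolding w_def[symmetric] real_norm_def
        by (subst abs_mult) (metis abs_ge_zero mult.commute mult_right_mono)
    qed
  qed
  have "((\<lambda>x. w x * (x * F x / (H x * (x\<^sup>2 + \<delta>\<^sup>2))) - \<alpha> * x * Hp x / (H x * (x\<^sup>2 + \<delta>\<^sup>2)) * (w x * stein_solution lam \<alpha> \<delta> P x)) \<longlongrightarrow> 0 - 0) at_top"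
    by (intro tendsto_diff 1 2)
  moreover have "w x * (x * F x / (H x * (x\<^sup>2 + \<delta>\<^sup>2))) - \<alpha> * x * Hp x / (H x * (x\<^sup>2 + \<delta>\<^sup>2)) * (w x * stein_solution lam \<alpha> \<delta> P x)
      = w x * (x * stein_slope lam \<alpha> \<delta> F P x)" for x
    unfolding stein_slope_def H_def[symmetric] Hp_def[symmetric] diff_divide_distrib by (simp add: algebra_simps)
  ultimately show "((\<lambda>x. gh_weight lam \<alpha> x * (x * stein_slope lam \<alpha> \<delta> F P x)) \<longlongrightarrow> 0) at_top"
    by (simp add: w_def)
qed

text \<open>
  The weight and the Bessel factors are even in x, so reflecting P and F reduces minus infinity to plus infinity.
\<close>

lemma stein_solution_decay:
  assumes a: "0 < \<alpha>" and d: "0 < \<delta>"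
    and P: "\<And>x. (P has_real_derivative stein_integrand lam \<alpha> \<delta> F x) (at x)"
    and F: "(F \<longlongrightarrow> 0) at_top" "(F \<longlongrightarrow> 0) at_bot"
  shows "((\<lambda>x. gh_weight lam \<alpha> x * stein_solution lam \<alpha> \<delta> P x) \<longlongrightarrow> 0) at_infinity"
    and "((\<lambda>x. gh_weight lam \<alpha> x * (x * stein_slope lam \<alpha> \<delta> F P x)) \<longlongrightarrow> 0) at_infinity"
proof -
  have P': "((\<lambda>x. P (- x)) has_real_derivative stein_integrand lam \<alpha> \<delta> (\<lambda>x. F (- x)) x) (at x)" for x
  proof -
    have "(uminus has_real_derivative - 1) (at x)" by (auto intro!: derivative_eq_intros)
    from DERIV_chain2[where g=uminus, OF P this] show ?thesis by (simp add: stein_integrand_def)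
  qed
  have F': "((\<lambda>x. F (- x)) \<longlongrightarrow> 0) at_top" using F(2) by (simp add: filterlim_at_bot_mirror)
  have w: "gh_weight lam \<alpha> (- x) = gh_weight lam \<alpha> x" for x by (simp add: gh_weight_def)
  have g: "stein_solution lam \<alpha> \<delta> P (- x) = stein_solution lam \<alpha> \<delta> (\<lambda>x. P (- x)) x" for x
    by (simp add: stein_solution_def)
  have G: "stein_slope lam \<alpha> \<delta> F P (- x) = stein_slope lam \<alpha> \<delta> (\<lambda>x. F (- x)) (\<lambda>x. P (- x)) x" for x
    unfolding stein_slope_def g by simp
  have 1: "((\<lambda>x. gh_weight lam \<alpha> x * stein_solution lam \<alpha> \<delta> P x) \<longlongrightarrow> 0) at_bot"
    unfolding filterlim_at_bot_mirror w g by (rule stein_solution_decay_at_top(1)[OF a d P' F'])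
  have 2: "((\<lambda>x. gh_weight lam \<alpha> x * (x * stein_slope lam \<alpha> \<delta> F P x)) \<longlongrightarrow> 0) at_bot"
    unfolding filterlim_at_bot_mirror w G
    using tendsto_minus[OF stein_solution_decay_at_top(2)[OF a d P' F']] by simp
  show "((\<lambda>x. gh_weight lam \<alpha> x * stein_solution lam \<alpha> \<delta> P x) \<longlongrightarrow> 0) at_infinity"
    unfolding at_infinity_eq_at_top_bot by (intro filterlim_sup 1 stein_solution_decay_at_top(1)[OF a d P F(1)])
  show "((\<lambda>x. gh_weight lam \<alpha> x * (x * stein_slope lam \<alpha> \<delta> F P x)) \<longlongrightarrow> 0) at_infinity"
    unfolding at_infinity_eq_at_top_bot by (intro filterlim_sup 2 stein_solution_decay_at_top(2)[OF a d P F(1)])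
qed

lemma gh_weight_exp_decay:
  assumes b: "\<bar>\<beta>\<bar> < \<alpha>"
  shows "((\<lambda>x. gh_weight lam \<alpha> x * exp (\<beta> * x)) \<longlongrightarrow> 0) at_infinity"
proof -
  have *: "((\<lambda>x::real. x powr lam * exp (- c * x)) \<longlongrightarrow> 0) at_top" if "0 < c" for c
    using that by real_asymp
  have e: "gh_weight lam \<alpha> x * exp (\<gamma> * x) = x powr lam * exp (- (\<alpha> - \<gamma>) * x)" if "0 < x" for x \<gamma>
    using that unfolding gh_weight_def mult.assoc exp_add[symmetric] by (simp add: algebra_simps)
  have top: "((\<lambda>x. gh_weight lam \<alpha> x * exp (\<gamma> * x)) \<longlongrightarrow> 0) at_top" if "\<gamma> < \<alpha>" for \<gamma>
  proof (rule Lim_transform_eventually)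
    show "((\<lambda>x::real. x powr lam * exp (- (\<alpha> - \<gamma>) * x)) \<longlongrightarrow> 0) at_top" by (rule *) (use that in simp)
    show "\<forall>\<^sub>F x in at_top. x powr lam * exp (- (\<alpha> - \<gamma>) * x) = gh_weight lam \<alpha> x * exp (\<gamma> * x)"
      using eventually_gt_at_top[of 0] by eventually_elim (use e in simp)
  qed
  have "((\<lambda>x. gh_weight lam \<alpha> x * exp (\<beta> * x)) \<longlongrightarrow> 0) at_bot"
    unfolding filterlim_at_bot_mirror using top[of "- \<beta>"] b by (simp add: gh_weight_def)
  with top[of \<beta>] b show ?thesis
    unfolding at_infinity_eq_at_top_bot by (intro filterlim_sup) auto
qed

text \<open>
  The flux is prescribed as the primitive of the density times h that vanishes at both infinities,
  which exists because h has mean zero.  Differentiating the flux returns the Stein equation off 0.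
\<close>

lemma stein_equation_solvable:
  assumes d: "0 < \<delta>" and b: "\<bar>\<beta>\<bar> < \<alpha>"
    and hc: "continuous_on UNIV h" and hB: "\<And>x. \<bar>h x\<bar> \<le> B"
    and mean: "(LINT x|gh_measure lam \<alpha> \<beta> \<delta>. h x) = 0"
  obtains f where "gh_test_function lam \<alpha> \<beta> \<delta> f" "\<And>x. x \<noteq> 0 \<Longrightarrow> gh_stein_op lam \<alpha> \<beta> \<delta> f x = h x"
proof -
  have a: "0 < \<alpha>" using b by simp
  interpret gh: prob_space "gh_measure lam \<alpha> \<beta> \<delta>" by (rule prob_space_gh_measure[OF d b])
  have sgh [measurable_cong]: "sets (gh_measure lam \<alpha> \<beta> \<delta>) = sets borel" by (simp add: gh_measure_def)
  have hm [measurable]: "h \<in> borel_measurable borel" by (rule borel_measurable_continuous_onI[OF hc])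
  have pm [measurable]: "gh_density lam \<alpha> \<beta> \<delta> \<in> borel_measurable borel" by (rule gh_density_measurable[OF d b])
  have p0: "0 \<le> gh_density lam \<alpha> \<beta> \<delta> x" for x using gh_density_pos[OF d b, of lam x] by simp
  define c where "c = gh_const lam \<alpha> \<beta> \<delta>"
  have c: "0 < c" using gh_const_pos[OF d b] by (simp add: c_def)
  define H where "H \<nu> x = scaled_bessel_K \<alpha> \<nu> (x\<^sup>2 + \<delta>\<^sup>2)" for \<nu> x
  have y: "0 < x\<^sup>2 + \<delta>\<^sup>2" for x using d by (simp add: add_nonneg_pos)
  have H0: "0 < H \<nu> x" for \<nu> x unfolding H_def by (rule scaled_bessel_K_radial_pos[OF a d])
  have Hc: "continuous_on UNIV (H \<nu>)" for \<nu>
    unfolding H_def[abs_def] by (rule continuous_on_scaled_bessel_K_radial[OF a d])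
  have Hd: "(H \<nu> has_real_derivative - \<alpha> * x * H (\<nu> - 1) x) (at x)" for \<nu> x
    unfolding H_def[abs_def] by (rule has_derivative_scaled_bessel_K_radial[OF a d])
  define \<phi> where "\<phi> x = exp (\<beta> * x) * H (lam - 1/2) x * h x" for x
  have pe: "gh_density lam \<alpha> \<beta> \<delta> x * h x = c * \<phi> x" for x
    unfolding gh_density_eq_scaled_bessel_K[OF d b] c_def \<phi>_def H_def by (simp add: mult_ac)
  have hi: "integrable (gh_measure lam \<alpha> \<beta> \<delta>) h"
    by (rule gh.integrable_const_bound[where B=B]) (use hB in auto)
  have "integrable lborel (\<lambda>x. gh_density lam \<alpha> \<beta> \<delta> x * h x)"
    using hi p0 unfolding gh_measure_def by (subst (asm) integrable_density) auto
  then have \<phi>i: "integrable lborel \<phi>" using c unfolding pe by simp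
  have "(LINT x|lborel. gh_density lam \<alpha> \<beta> \<delta> x * h x) = 0"
    using mean p0 unfolding gh_measure_def by (subst (asm) integral_density) auto
  then have \<phi>0: "(LINT x|lborel. \<phi> x) = 0" using c unfolding pe by simp
  have \<phi>c: "continuous_on UNIV \<phi>"
    unfolding \<phi>_def[abs_def] by (intro continuous_intros Hc hc)
  obtain F where F: "\<And>x. (F has_real_derivative \<phi> x) (at x)" "(F \<longlongrightarrow> 0) at_top" "(F \<longlongrightarrow> 0) at_bot"
    using primitive_vanishing_at_infinity[OF \<phi>c \<phi>i \<phi>0] by blast
  have Fc: "continuous_on UNIV F" using DERIV_isCont[OF F(1)] by (auto intro: continuous_at_imp_continuous_on)
  have ic: "continuous_on UNIV (stein_integrand lam \<alpha> \<delta> F)"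
    unfolding stein_integrand_def[abs_def] H_def[symmetric]
    by (intro continuous_intros Hc Fc) (use H0 y in \<open>auto simp: less_imp_neq[THEN not_sym] powr_def\<close>)
  obtain P where P: "\<And>x. (P has_real_derivative stein_integrand lam \<alpha> \<delta> F x) (at x)"
  proof -
    have "\<exists>P. \<forall>x::real. - \<infinity> < ereal x \<longrightarrow> ereal x < \<infinity> \<longrightarrow> (P has_vector_derivative stein_integrand lam \<alpha> \<delta> F x) (at x)"
      by (rule einterval_antiderivative) (use ic in \<open>auto simp: continuous_on_eq_continuous_at\<close>)
    then show ?thesis using that by (auto simp: has_real_derivative_iff_has_vector_derivative)
  qed
  define g where "g = stein_solution lam \<alpha> \<delta> P"
  define G where "G = stein_slope lam \<alpha> \<delta> F P"
  define g1 where "g1 x = x * G x" for x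
  have gd: "(g has_real_derivative g1 x) (at x)" for x
    unfolding g_def g1_def G_def by (rule has_derivative_stein_solution[OF a d P])
  \<comment> \<open>Numerator and denominator of G, which is thereby differentiable on the whole line.\<close>
  define N where "N x = F x - \<alpha> * H (lam + 1/2) x * g x" for x
  define N' where "N' x = \<phi> x - (\<alpha> * H (lam + 1/2) x * g1 x + - \<alpha> * x * H (lam - 1/2) x * \<alpha> * g x)" for x
  define D where "D x = H (lam - 1/2) x * (x\<^sup>2 + \<delta>\<^sup>2)" for x
  define D' where "D' x = H (lam - 1/2) x * (2 * x) + - \<alpha> * x * H (lam - 1/2 - 1) x * (x\<^sup>2 + \<delta>\<^sup>2)" for x
  have D0: "D x \<noteq> 0" for x unfolding D_def using H0[of "lam - 1/2" x] y[of x] by (metis less_irrefl mult_pos_pos)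
  have GN: "G = (\<lambda>x. N x / D x)"
    unfolding G_def stein_slope_def[abs_def] N_def D_def g_def H_def ..
  have Nd: "(N has_real_derivative N' x) (at x)" for x
  proof -
    have e: "lam + 1/2 - 1 = lam - 1/2" by simp
    show ?thesis unfolding N_def[abs_def] N'_def
      by (rule DERIV_cong[OF DERIV_diff[OF F(1) DERIV_mult[OF DERIV_cmult[OF Hd] gd]]])
        (simp only: e, simp add: algebra_simps)
  qed
  have yd: "((\<lambda>x. x\<^sup>2 + \<delta>\<^sup>2) has_real_derivative 2 * x) (at x)" for x
    by (auto intro!: derivative_eq_intros)
  have Dd: "(D has_real_derivative D' x) (at x)" for x
    unfolding D_def[abs_def] D'_def
    by (rule DERIV_cong[OF DERIV_mult[OF Hd yd]]) (simp add: algebra_simps)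
  define G1 where "G1 x = (N' x * D x - N x * D' x) / (D x * D x)" for x
  have Gd: "(G has_real_derivative G1 x) (at x)" for x
    unfolding GN G1_def by (rule DERIV_divide[OF Nd Dd D0])
  define g2 where "g2 x = G x + x * G1 x" for x
  have g1d: "(g1 has_real_derivative g2 x) (at x)" for x
    unfolding g1_def[abs_def] g2_def
    by (rule DERIV_cong[OF DERIV_mult[OF DERIV_ident Gd]]) simp
  have cD: "continuous_on UNIV u" if "\<And>x. (u has_real_derivative u' x) (at x)" for u u' :: "real \<Rightarrow> real"
    using DERIV_isCont[OF that] by (auto intro: continuous_at_imp_continuous_on)
  have g2c: "continuous_on UNIV g2"
    unfolding g2_def[abs_def] G1_def N'_def D'_def
    by (intro continuous_intros cD[OF Gd] cD[OF Nd] cD[OF Dd] \<phi>c Hc cD[OF gd] cD[OF g1d]) (use D0 in auto)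
  have eq: "(x\<^sup>2 + \<delta>\<^sup>2) / x * g2 x + (2 * lam - \<delta>\<^sup>2 / x\<^sup>2) * g1 x - \<alpha>\<^sup>2 * x * g x = exp (\<beta> * x) * h x"
    if x: "x \<noteq> 0" for x
  proof -
    have "(stein_flux lam \<alpha> \<delta> g g1 has_real_derivative \<phi> x) (at x)"
    proof (rule has_field_derivative_transform_within_open[OF F(1)])
      show "open (- {0::real})" "x \<in> - {0}" using x by auto
      fix z :: real assume "z \<in> - {0}"
      then show "F z = stein_flux lam \<alpha> \<delta> g g1 z"
        using stein_flux_solution[OF a d, of z lam P F] unfolding g_def g1_def[abs_def] G_def by simp
    qed
    from DERIV_unique[OF this has_derivative_stein_flux[OF a d x gd g1d]]
    show ?thesis using H0[of "lam - 1/2" x] by (simp add: \<phi>_def H_def)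
  qed
  define f where "f x = exp (- \<beta> * x) * g x" for x
  define f1 where "f1 x = exp (- \<beta> * x) * (g1 x - \<beta> * g x)" for x
  define f2 where "f2 x = exp (- \<beta> * x) * (g2 x - 2 * \<beta> * g1 x + \<beta>\<^sup>2 * g x)" for x
  have fd: "(f has_real_derivative f1 x) (at x)" for x
    unfolding f_def f1_def by (auto intro!: derivative_eq_intros gd simp: algebra_simps)
  have f1d: "(f1 has_real_derivative f2 x) (at x)" for x
    unfolding f1_def f2_def by (auto intro!: derivative_eq_intros gd g1d simp: algebra_simps power2_eq_square)
  have f2c: "continuous_on UNIV f2"
    unfolding f2_def[abs_def] by (intro continuous_intros g2c cD[OF gd] cD[OF g1d])
  have df: "deriv f = f1" using DERIV_imp_deriv[OF fd] by auto
  have df1: "deriv f1 = f2" using DERIV_imp_deriv[OF f1d] by auto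
  have op: "gh_stein_op lam \<alpha> \<beta> \<delta> f x = h x" if x: "x \<noteq> 0" for x
  proof -
    have ee: "exp (\<beta> * x) * (exp (- \<beta> * x) * t) = t" for t
      by (simp add: mult.assoc[symmetric] exp_add[symmetric])
    have e0: "exp (\<beta> * x) * f x = g x" unfolding f_def by (rule ee)
    have e1: "exp (\<beta> * x) * (f1 x + \<beta> * f x) = g1 x"
      unfolding f1_def f_def using ee[of "g1 x"] by (simp add: algebra_simps)
    have e2: "exp (\<beta> * x) * (f2 x + 2 * \<beta> * f1 x + \<beta>\<^sup>2 * f x) = g2 x"
      unfolding f2_def f1_def f_def using ee[of "g2 x"] by (simp add: algebra_simps power2_eq_square)
    have "exp (\<beta> * x) * gh_stein_op lam \<alpha> \<beta> \<delta> f x = exp (\<beta> * x) * h x"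
      unfolding gh_stein_op_conjugate[OF x fd f1d] e0 e1 e2 by (rule eq[OF x])
    then show ?thesis by simp
  qed
  have test: "gh_test_function lam \<alpha> \<beta> \<delta> f"
    unfolding gh_test_function_def
  proof (intro conjI ballI)
    show "piecewise_C2 f"
      unfolding piecewise_C2_def
    proof (intro conjI allI)
      show "f differentiable (at x)" for x using fd real_differentiable_def by blast
      have "f1 C1_differentiable_on UNIV"
        unfolding C1_differentiable_on_def
        using f1d f2c by (auto simp: has_real_derivative_iff_has_vector_derivative[symmetric])
      then show "deriv f piecewise_C1_differentiable_on UNIV"
        unfolding df using cD[OF f1d] by (simp add: C1_differentiable_imp_piecewise)
    qed
    show "deriv f differentiable (at 0)" unfolding df using f1d real_differentiable_def by blast
    show "integrable (gh_measure lam \<alpha> \<beta> \<delta>) (gh_stein_op lam \<alpha> \<beta> \<delta> f)"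
    proof (rule gh.integrable_const_bound[where B="max B \<bar>gh_stein_op lam \<alpha> \<beta> \<delta> f 0\<bar>"])
      \<comment> \<open>At 0 division by zero gives the operator a value unrelated to h; one more point does not affect boundedness.\<close>
      have e: "gh_stein_op lam \<alpha> \<beta> \<delta> f = (\<lambda>x. if x = 0 then gh_stein_op lam \<alpha> \<beta> \<delta> f 0 else h x)"
        using op by auto
      show "gh_stein_op lam \<alpha> \<beta> \<delta> f \<in> borel_measurable (gh_measure lam \<alpha> \<beta> \<delta>)"
        by (subst e) measurable
      show "AE x in gh_measure lam \<alpha> \<beta> \<delta>. norm (gh_stein_op lam \<alpha> \<beta> \<delta> f x) \<le> max B \<bar>gh_stein_op lam \<alpha> \<beta> \<delta> f 0\<bar>"
        by (subst e) (use hB in \<open>auto simp: le_max_iff_disj\<close>)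
    qed
    note dec = stein_solution_decay[OF a d P F(2,3), folded g_def G_def g1_def]
    have 0: "((\<lambda>x. gh_weight lam \<alpha> x * g x) \<longlongrightarrow> 0) at_infinity" by (rule dec(1))
    have 1: "((\<lambda>x. gh_weight lam \<alpha> x * g1 x) \<longlongrightarrow> 0) at_infinity" by (rule dec(2))
    have 2: "((\<lambda>x. gh_weight lam \<alpha> x * g2 x) \<longlongrightarrow> 0) at_infinity"
    proof -
      \<comment> \<open>The Stein equation divided by \<open>y / x\<close> expresses g2 through g, g1 and h; for \<open>\<bar>x\<bar> \<ge> 1\<close> that quotient has modulus at least \<open>\<bar>x\<bar>\<close>.\<close>
      define R where "R x = \<bar>B\<bar> * \<bar>gh_weight lam \<alpha> x * exp (\<beta> * x)\<bar> + (2 * \<bar>lam\<bar> + 1) * \<bar>gh_weight lam \<alpha> x * g1 x\<bar> + \<alpha>\<^sup>2 * \<bar>gh_weight lam \<alpha> x * g x\<bar>" for x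
      have "(R \<longlongrightarrow> \<bar>B\<bar> * \<bar>0\<bar> + (2 * \<bar>lam\<bar> + 1) * \<bar>0\<bar> + \<alpha>\<^sup>2 * \<bar>0\<bar>) at_infinity"
        unfolding R_def[abs_def] by (intro tendsto_intros 0 1 gh_weight_exp_decay[OF b])
      then have R: "(R \<longlongrightarrow> 0) at_infinity" by simp
      show ?thesis
      proof (rule Lim_null_comparison[OF _ R])
        show "\<forall>\<^sub>F x in at_infinity. norm (gh_weight lam \<alpha> x * g2 x) \<le> R x"
          using eventually_abs_ge_at_infinity[of "max 1 \<delta>"]
        proof eventually_elim
          case (elim x)
          then have x: "1 \<le> \<bar>x\<bar>" "\<delta> \<le> \<bar>x\<bar>" "x \<noteq> 0" by auto
          have dx: "\<delta>\<^sup>2 / x\<^sup>2 \<le> 1"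
            using power_mono[OF x(2), of 2] d x(3) by (simp add: divide_le_eq)
          have "\<bar>x\<bar> * \<bar>g2 x\<bar> \<le> \<bar>(x\<^sup>2 + \<delta>\<^sup>2) / x * g2 x\<bar>"
          proof -
            have "\<bar>x\<bar> = x\<^sup>2 / \<bar>x\<bar>" using x(3) by (metis abs_mult_self_eq nonzero_mult_div_cancel_left power2_eq_square abs_eq_0)
            also have "\<dots> \<le> (x\<^sup>2 + \<delta>\<^sup>2) / \<bar>x\<bar>" by (intro divide_right_mono) auto
            finally show ?thesis
              unfolding abs_mult abs_divide abs_of_pos[OF y[of x]] by (rule mult_right_mono) simp
          qed
          also have "(x\<^sup>2 + \<delta>\<^sup>2) / x * g2 x = exp (\<beta> * x) * h x - (2 * lam - \<delta>\<^sup>2 / x\<^sup>2) * g1 x + \<alpha>\<^sup>2 * x * g x"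
            using eq[OF x(3)] by linarith
          also have "\<bar>\<dots>\<bar> \<le> \<bar>exp (\<beta> * x) * h x\<bar> + \<bar>(2 * lam - \<delta>\<^sup>2 / x\<^sup>2) * g1 x\<bar> + \<bar>\<alpha>\<^sup>2 * x * g x\<bar>"
            by linarith
          also have "\<bar>exp (\<beta> * x) * h x\<bar> \<le> \<bar>x\<bar> * (\<bar>B\<bar> * exp (\<beta> * x))"
          proof -
            have "\<bar>h x\<bar> \<le> \<bar>x\<bar> * \<bar>B\<bar>"
              using hB[of x] abs_ge_self[of B] mult_right_mono[OF x(1), of "\<bar>B\<bar>"] by linarith
            then show ?thesis by (simp add: abs_mult mult_left_mono mult_ac)
          qed
          also have "\<bar>(2 * lam - \<delta>\<^sup>2 / x\<^sup>2) * g1 x\<bar> \<le> \<bar>x\<bar> * ((2 * \<bar>lam\<bar> + 1) * \<bar>g1 x\<bar>)"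
          proof -
            have "0 \<le> \<delta>\<^sup>2 / x\<^sup>2" by simp
            then have "\<bar>2 * lam - \<delta>\<^sup>2 / x\<^sup>2\<bar> \<le> 2 * \<bar>lam\<bar> + 1" using dx by linarith
            also have "\<dots> \<le> \<bar>x\<bar> * (2 * \<bar>lam\<bar> + 1)" using mult_right_mono[OF x(1), of "2 * \<bar>lam\<bar> + 1"] by simp
            finally show ?thesis unfolding abs_mult mult.assoc[symmetric] by (rule mult_right_mono) simp
          qed
          also have "\<bar>\<alpha>\<^sup>2 * x * g x\<bar> = \<bar>x\<bar> * (\<alpha>\<^sup>2 * \<bar>g x\<bar>)" by (simp add: abs_mult)
          finally have "\<bar>x\<bar> * \<bar>g2 x\<bar> \<le> \<bar>x\<bar> * (\<bar>B\<bar> * exp (\<beta> * x) + (2 * \<bar>lam\<bar> + 1) * \<bar>g1 x\<bar> + \<alpha>\<^sup>2 * \<bar>g x\<bar>)"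
            by (simp add: distrib_left)
          then have "\<bar>g2 x\<bar> \<le> \<bar>B\<bar> * exp (\<beta> * x) + (2 * \<bar>lam\<bar> + 1) * \<bar>g1 x\<bar> + \<alpha>\<^sup>2 * \<bar>g x\<bar>"
            using x(3) by (subst (asm) mult_le_cancel_left_pos) auto
          then have "gh_weight lam \<alpha> x * \<bar>g2 x\<bar> \<le> gh_weight lam \<alpha> x * (\<bar>B\<bar> * exp (\<beta> * x) + (2 * \<bar>lam\<bar> + 1) * \<bar>g1 x\<bar> + \<alpha>\<^sup>2 * \<bar>g x\<bar>)"
            by (rule mult_left_mono) (simp add: gh_weight_def)
          moreover have "\<bar>gh_weight lam \<alpha> x\<bar> = gh_weight lam \<alpha> x" by (simp add: gh_weight_def)
          ultimately show ?case unfolding R_def real_norm_def abs_mult by (simp add: algebra_simps)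
        qed
      qed
    qed
    fix k :: nat assume "k \<in> {0, 1, 2}"
    then consider "k = 0" | "k = 1" | "k = 2" by auto
    then show "((\<lambda>x. \<bar>x\<bar> powr lam * exp (- \<alpha> * \<bar>x\<bar> + \<beta> * x) * (deriv ^^ k) f x) \<longlongrightarrow> 0) at_infinity"
    proof cases
      have ew: "\<bar>x\<bar> powr lam * exp (- \<alpha> * \<bar>x\<bar> + \<beta> * x) * (exp (- \<beta> * x) * t) = gh_weight lam \<alpha> x * t" for x t
        unfolding gh_weight_def exp_add by (simp add: exp_minus field_simps)
      {
        case 1
        then show ?thesis using 0 by (simp only: funpow.simps id_apply f_def ew)
      next
        case 2
        have "((\<lambda>x. gh_weight lam \<alpha> x * g1 x - \<beta> * (gh_weight lam \<alpha> x * g x)) \<longlongrightarrow> 0 - \<beta> * 0) at_infinity"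
          by (intro tendsto_intros 0 1)
        then have "((\<lambda>x. gh_weight lam \<alpha> x * (g1 x - \<beta> * g x)) \<longlongrightarrow> 0) at_infinity" by (simp add: algebra_simps)
        then show ?thesis using 2 by (simp only: One_nat_def funpow.simps comp_def id_apply df f1_def ew)
      next
        case 3
        have "((\<lambda>x. gh_weight lam \<alpha> x * g2 x - 2 * \<beta> * (gh_weight lam \<alpha> x * g1 x) + \<beta>\<^sup>2 * (gh_weight lam \<alpha> x * g x))
            \<longlongrightarrow> 0 - 2 * \<beta> * 0 + \<beta>\<^sup>2 * 0) at_infinity"
          by (intro tendsto_intros 0 1 \<open>((\<lambda>x. gh_weight lam \<alpha> x * g2 x) \<longlongrightarrow> 0) at_infinity\<close>)
        then have "((\<lambda>x. gh_weight lam \<alpha> x * (g2 x - 2 * \<beta> * g1 x + \<beta>\<^sup>2 * g x)) \<longlongrightarrow> 0) at_infinity" by (simp add: algebra_simps)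
        then show ?thesis using 3 by (simp only: numeral_2_eq_2 funpow.simps comp_def id_apply df df1 f2_def ew)
      }
    qed
  qed
  show ?thesis by (rule that[OF test op])
qed

section \<open>Characterisation of the generalised hyperbolic law\<close>

theorem proposition3p1:
  fixes lam \<alpha> \<beta> \<delta> :: real and M :: "'a measure" and W :: "'a \<Rightarrow> real"
  assumes "\<delta> > 0" and "\<alpha> > \<bar>\<beta>\<bar>"
    and "prob_space M" and "W \<in> borel_measurable M"
  shows "distributed M lborel W (\<lambda>x. ennreal (gh_density lam \<alpha> \<beta> \<delta> x)) \<longleftrightarrow>
    (\<forall>f. gh_test_function lam \<alpha> \<beta> \<delta> f \<longrightarrow>
       (AE \<omega> in M. W \<omega> \<noteq> 0) \<and>
       integrable M (\<lambda>\<omega>. gh_stein_op lam \<alpha> \<beta> \<delta> f (W \<omega>)) \<and>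
       prob_space.expectation M (\<lambda>\<omega>. gh_stein_op lam \<alpha> \<beta> \<delta> f (W \<omega>)) = 0)"
proof
  interpret prob_space M by fact
  have W [measurable]: "W \<in> measurable M lborel" using assms(4) by simp
  {
    assume "distributed M lborel W (\<lambda>x. ennreal (gh_density lam \<alpha> \<beta> \<delta> x))"
    then have eq: "distr M lborel W = gh_measure lam \<alpha> \<beta> \<delta>"
      by (simp add: distributed_def gh_measure_def)
    have "AE x in gh_measure lam \<alpha> \<beta> \<delta>. x \<noteq> 0"
      unfolding gh_measure_def
      by (subst AE_density) (use gh_density_measurable[OF assms(1,2)] AE_lborel_singleton[of 0] in
        \<open>auto elim: eventually_mono\<close>)
    then have AE0: "AE \<omega> in M. W \<omega> \<noteq> 0"
      unfolding eq[symmetric] by (rule AE_distrD[OF W])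
    show "\<forall>f. gh_test_function lam \<alpha> \<beta> \<delta> f \<longrightarrow>
       (AE \<omega> in M. W \<omega> \<noteq> 0) \<and>
       integrable M (\<lambda>\<omega>. gh_stein_op lam \<alpha> \<beta> \<delta> f (W \<omega>)) \<and>
       expectation (\<lambda>\<omega>. gh_stein_op lam \<alpha> \<beta> \<delta> f (W \<omega>)) = 0"
    proof (intro allI impI conjI AE0)
      fix f assume f: "gh_test_function lam \<alpha> \<beta> \<delta> f"
      then have int: "integrable (distr M lborel W) (gh_stein_op lam \<alpha> \<beta> \<delta> f)"
        unfolding eq gh_test_function_def by blast
      then have m: "gh_stein_op lam \<alpha> \<beta> \<delta> f \<in> borel_measurable lborel"
        using borel_measurable_integrable by fastforce
      show "integrable M (\<lambda>\<omega>. gh_stein_op lam \<alpha> \<beta> \<delta> f (W \<omega>))"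
        using int integrable_distr_eq[OF W m] by simp
      show "expectation (\<lambda>\<omega>. gh_stein_op lam \<alpha> \<beta> \<delta> f (W \<omega>)) = 0"
        using stein_identity_gh[OF assms(1,2) f] integral_distr[OF W m] unfolding eq by simp
    qed
  }
  assume stein: "\<forall>f. gh_test_function lam \<alpha> \<beta> \<delta> f \<longrightarrow>
       (AE \<omega> in M. W \<omega> \<noteq> 0) \<and>
       integrable M (\<lambda>\<omega>. gh_stein_op lam \<alpha> \<beta> \<delta> f (W \<omega>)) \<and>
       expectation (\<lambda>\<omega>. gh_stein_op lam \<alpha> \<beta> \<delta> f (W \<omega>)) = 0"
  interpret gh: prob_space "gh_measure lam \<alpha> \<beta> \<delta>" by (rule prob_space_gh_measure[OF assms(1,2)])
  interpret D: prob_space "distr M lborel W" by (rule prob_space_distr[OF W])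
  have sets_gh [measurable_cong]: "sets (gh_measure lam \<alpha> \<beta> \<delta>) = sets borel" by (simp add: gh_measure_def)
  interpret rgh: real_distribution "gh_measure lam \<alpha> \<beta> \<delta>"
    by unfold_locales (simp add: gh_measure_def)
  interpret rD: real_distribution "distr M lborel W"
    by unfold_locales simp
  have mean_eq: "(LINT x|distr M lborel W. h x) = (LINT x|gh_measure lam \<alpha> \<beta> \<delta>. h x)"
    if hc: "continuous_on UNIV h" and hB: "\<And>x. \<bar>h x\<bar> \<le> B" for h :: "real \<Rightarrow> real" and B
  proof -
    have hm [measurable]: "h \<in> borel_measurable borel" by (rule borel_measurable_continuous_onI[OF hc])
    define m where "m = (LINT x|gh_measure lam \<alpha> \<beta> \<delta>. h x)"
    have hi: "integrable (gh_measure lam \<alpha> \<beta> \<delta>) h"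
      by (rule gh.integrable_const_bound[where B=B]) (use hB in auto)
    have hW: "integrable M (\<lambda>\<omega>. h (W \<omega>))"
      by (rule integrable_const_bound[where B=B])
        (use hB measurable_compose[OF assms(4) hm] in auto)
    have centred: "(LINT x|gh_measure lam \<alpha> \<beta> \<delta>. h x - m) = 0"
      using hi gh.prob_space by (simp add: m_def)
    have bound: "\<bar>h x - m\<bar> \<le> B + \<bar>m\<bar>" for x using hB[of x] by linarith
    have cont: "continuous_on UNIV (\<lambda>x. h x - m)" by (intro continuous_intros hc)
    obtain f where f: "gh_test_function lam \<alpha> \<beta> \<delta> f" "\<And>x. x \<noteq> 0 \<Longrightarrow> gh_stein_op lam \<alpha> \<beta> \<delta> f x = h x - m"
      using stein_equation_solvable[OF assms(1,2) cont bound centred] by blast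
    have "AE \<omega> in M. W \<omega> \<noteq> 0" and i: "integrable M (\<lambda>\<omega>. gh_stein_op lam \<alpha> \<beta> \<delta> f (W \<omega>))"
      and e: "expectation (\<lambda>\<omega>. gh_stein_op lam \<alpha> \<beta> \<delta> f (W \<omega>)) = 0"
      using stein f(1) by auto
    then have "AE \<omega> in M. gh_stein_op lam \<alpha> \<beta> \<delta> f (W \<omega>) = h (W \<omega>) - m"
      by (auto elim!: eventually_mono simp: f(2))
    then have "expectation (\<lambda>\<omega>. h (W \<omega>) - m) = 0"
      using e integral_cong_AE[OF borel_measurable_integrable[OF i], of "\<lambda>\<omega>. h (W \<omega>) - m"]
        borel_measurable_integrable[OF hW] by simp
    then have "expectation (\<lambda>\<omega>. h (W \<omega>)) = m"
      using hW by (simp add: prob_space)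
    then show ?thesis using integral_distr[OF W, of h] hm by (simp add: m_def)
  qed
  have "char (distr M lborel W) = char (gh_measure lam \<alpha> \<beta> \<delta>)"
  proof
    fix t
    have "(LINT x|distr M lborel W. cos (t * x)) = (LINT x|gh_measure lam \<alpha> \<beta> \<delta>. cos (t * x))"
    proof (rule mean_eq)
      show "\<bar>cos (t * x)\<bar> \<le> 1" for x by simp
    qed (intro continuous_intros)
    moreover have "(LINT x|distr M lborel W. sin (t * x)) = (LINT x|gh_measure lam \<alpha> \<beta> \<delta>. sin (t * x))"
    proof (rule mean_eq)
      show "\<bar>sin (t * x)\<bar> \<le> 1" for x by simp
    qed (intro continuous_intros)
    moreover have "char N t = Complex (LINT x|N. cos (t * x)) (LINT x|N. sin (t * x))"
      if "real_distribution N" for N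
    proof -
      interpret N: real_distribution N by fact
      have i: "integrable N (\<lambda>x. iexp (t * x))" by (rule N.integrable_iexp) auto
      show ?thesis
        unfolding char_def complex_eq_iff
        using integral_Re[OF i] integral_Im[OF i] by (simp add: Re_exp Im_exp)
    qed
    ultimately show "char (distr M lborel W) t = char (gh_measure lam \<alpha> \<beta> \<delta>) t"
      using rgh.real_distribution_axioms rD.real_distribution_axioms by simp
  qed
  then have "distr M lborel W = gh_measure lam \<alpha> \<beta> \<delta>"
    by (intro Levy_uniqueness rgh.real_distribution_axioms rD.real_distribution_axioms)
  then show "distributed M lborel W (\<lambda>x. ennreal (gh_density lam \<alpha> \<beta> \<delta> x))"
    using W gh_density_measurable[OF assms(1,2)] by (simp add: distributed_def gh_measure_def)
qed

end
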